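(* Let $n\ge5$ and $\ell_1\ge3$ be two integers, and let $S=K[x_1,\ldots,x_n]$ be a polynomial ring over a field $K$. Given $n-\ell_1$ pairs of positive integers $$(k_1,\ell_1),(k_2,\ell_2),\ldots,(k_{n-\ell_1},\ell_{n-\ell_1}),$$ with $1\le k_{n-\ell_1}<k_{n-\ell_1-1}<\cdots<k_1\le n-3$ and $3\le\ell_1<\ell_2<\cdots<\ell_{n-\ell_1}\le n-1$, there exists a squarefree lexsegment ideal $I$ of $S$ of initial degree $\ell_1$ having these pairs as corners if and only if $k_i+\ell_i=n$ for $i=1,\ldots,n-\ell_1$.
   Context: A squarefree monomial ideal is a monomial ideal generated by squarefree monomials. Squarefree monomials of the same degree $d$ are ordered by the squarefree lex order: for $u=x_{i_1}\cdots x_{i_d}$, $v=x_{j_1}\cdots x_{j_d}$ with increasing indices, $u>_{\mathrm{slex}}v$ if for some $s$ one has $i_1=j_1,\ldots,i_{s-1}=j_{s-1}$ and $i_s<j_s$. A squarefree monomial ideal $I$ is a squarefree lexsegment (squarefree lex) ideal if for all squarefree monomials $u\in I$ and all squarefree monomials $v$ of the same degree with $v>_{\mathrm{slex}}u$, one has $v\in I$. The initial degree of a graded ideal $I$ is the minimum $j$ with $I_j\ne0$. For a graded ideal $I$, $\beta_{i,j}(I)=\dim_K\mathrm{Tor}_i(K,I)_j$. A graded Betti number $\beta_{k,k+\ell}(I)\ne0$ is extremal if $\beta_{i,i+j}(I)=0$ for all $i\ge k$, $j\ge\ell$, $(i,j)\ne(k,\ell)$; the pair $(k,\ell)$ is then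 called a corner of $I$. *)

theory Defs
  imports
    "HOL-Library.Poly_Mapping"
    "HOL-Library.Function_Algebras"
    "HOL-Algebra.Ideal"
    "HOL.Vector_Spaces"
begin

section \<open>The polynomial ring and its graded ideals\<close>

type_synonym monomial = "nat \<Rightarrow>\<^sub>0 nat"

type_synonym 'k mpoly = "monomial \<Rightarrow>\<^sub>0 'k"

definition monomials :: "nat \<Rightarrow> monomial set" where
  "monomials n = {m. Poly_Mapping.keys m \<subseteq> {1..n}}"

definition mdeg :: "monomial \<Rightarrow> nat" where
  "mdeg m = (\<Sum>i\<in>Poly_Mapping.keys m. Poly_Mapping.lookup m i)"

definition monom_poly :: "monomial \<Rightarrow> 'k::field mpoly" where
  "monom_poly m = Poly_Mapping.single m 1"

definition var_poly :: "nat \<Rightarrow> 'k::field mpoly" where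
  "var_poly t = monom_poly (Poly_Mapping.single t 1)"

text \<open>The ring \<open>K[x_1, \<dots>, x_n]\<close>, for \<open>K\<close> the field type \<open>'k\<close>.\<close>

definition poly_ring :: "nat \<Rightarrow> 'k::field mpoly ring" where
  "poly_ring n = \<lparr>carrier = {p. Poly_Mapping.keys p \<subseteq> monomials n}, monoid.mult = (*), one = 1, zero = 0, add = (+)\<rparr>"

definition homogeneous :: "nat \<Rightarrow> 'k::field mpoly \<Rightarrow> bool" where
  "homogeneous d p \<longleftrightarrow> (\<forall>m\<in>Poly_Mapping.keys p. mdeg m = d)"

text \<open>A predicate rather than a function, because the zero ideal has no initial degree.\<close>

definition has_initial_degree :: "'k::field mpoly set \<Rightarrow> nat \<Rightarrow> bool" where
  "has_initial_degree I d \<longleftrightarrow>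
     (\<exists>p\<in>I. p \<noteq> 0 \<and> homogeneous d p) \<and>
     (\<forall>j<d. \<not> (\<exists>p\<in>I. p \<noteq> 0 \<and> homogeneous j p))"

section \<open>Squarefree lexsegment ideals\<close>

definition squarefree_monomials :: "nat \<Rightarrow> monomial set" where
  "squarefree_monomials n = {m \<in> monomials n. \<forall>i. Poly_Mapping.lookup m i \<le> 1}"

definition squarefree_monomial_ideal :: "nat \<Rightarrow> 'k::field mpoly set \<Rightarrow> bool" where
  "squarefree_monomial_ideal n I \<longleftrightarrow>
     (\<exists>G \<subseteq> squarefree_monomials n. I = Idl\<^bsub>poly_ring n\<^esub> (monom_poly ` G))"

text \<open>Meant for squarefree monomials of the same degree; the lists are the increasing sequences
  of the indices of the variables occurring in \<open>u\<close> and \<open>v\<close>.\<close>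

definition slex_greater :: "monomial \<Rightarrow> monomial \<Rightarrow> bool" where
  "slex_greater u v \<longleftrightarrow>
     (let is = sorted_list_of_set (Poly_Mapping.keys u); js = sorted_list_of_set (Poly_Mapping.keys v)
      in \<exists>s. s < length is \<and> s < length js \<and> take s is = take s js \<and> is ! s < js ! s)"

definition squarefree_lexsegment_ideal :: "nat \<Rightarrow> 'k::field mpoly set \<Rightarrow> bool" where
  "squarefree_lexsegment_ideal n I \<longleftrightarrow>
     squarefree_monomial_ideal n I \<and>
     (\<forall>u\<in>squarefree_monomials n. \<forall>v\<in>squarefree_monomials n.
        monom_poly u \<in> I \<and> mdeg v = mdeg u \<and> slex_greater v u \<longrightarrow> monom_poly v \<in> I)"

section \<open>Complexes of graded free modules\<close>

text \<open>A complex of finitely generated graded free modules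
  \<open>F_i = \<Oplus>b\<in>basis F i. S(- shift F i b)\<close> is given by homogeneous bases and the matrices of its
  differentials: \<open>entry F i b c\<close> is the entry in row \<open>b \<in> basis F (i - 1)\<close> and column
  \<open>c \<in> basis F i\<close> of the differential from \<open>F_i\<close> to \<open>F_(i-1)\<close>.\<close>

record (overloaded) ('b, 'k) graded_complex =
  basis :: "nat \<Rightarrow> 'b set"
  shift :: "nat \<Rightarrow> 'b \<Rightarrow> nat"
  entry :: "nat \<Rightarrow> 'b \<Rightarrow> 'b \<Rightarrow> 'k mpoly"

text \<open>As \<open>F_i\<close> is free, \<open>F_i \<otimes> I\<close> is the direct sum of copies of \<open>I\<close> indexed by the basis,
  that is, the set of families of elements of \<open>I\<close>. Taking \<open>I = S\<close> gives \<open>F_i\<close> itself.\<close>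

definition tensor_chains ::
    "('b, 'k::field) graded_complex \<Rightarrow> 'k mpoly set \<Rightarrow> nat \<Rightarrow> ('b \<Rightarrow> 'k mpoly) set" where
  "tensor_chains F I i = {v. (\<forall>b\<in>basis F i. v b \<in> I) \<and> (\<forall>b. b \<notin> basis F i \<longrightarrow> v b = 0)}"

definition tensor_chains_deg ::
    "('b, 'k::field) graded_complex \<Rightarrow> 'k mpoly set \<Rightarrow> nat \<Rightarrow> nat \<Rightarrow> ('b \<Rightarrow> 'k mpoly) set" where
  "tensor_chains_deg F I i j =
     {v \<in> tensor_chains F I i. \<forall>b\<in>basis F i. \<forall>m\<in>Poly_Mapping.keys (v b). mdeg m + shift F i b = j}"

definition differential ::
    "('b, 'k::field) graded_complex \<Rightarrow> nat \<Rightarrow> ('b \<Rightarrow> 'k mpoly) \<Rightarrow> ('b \<Rightarrow> 'k mpoly)" where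
  "differential F i v =
     (\<lambda>b. if i \<noteq> 0 \<and> b \<in> basis F (i - 1) then \<Sum>c\<in>basis F i. entry F i b c * v c else 0)"

text \<open>The residue field \<open>K = S/(x_1, \<dots>, x_n)\<close> is concentrated in degree 0, with quotient map
  \<open>p \<mapsto> Poly_Mapping.lookup p 0\<close>. Hence a homogeneous augmentation \<open>F_0 \<rightarrow> K\<close> is given by scalars \<open>e b\<close>,
  the images of the basis elements, which vanish unless \<open>b\<close> has degree 0.\<close>

definition graded_free_resolution_of_field :: "nat \<Rightarrow> ('b, 'k::field) graded_complex \<Rightarrow> bool" where
  "graded_free_resolution_of_field n F \<longleftrightarrow>
     (\<forall>i. finite (basis F i)) \<and>
     (\<forall>i. \<forall>b\<in>basis F i. \<forall>c\<in>basis F (Suc i).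
        entry F (Suc i) b c \<in> carrier (poly_ring n) \<and>
        (\<forall>m\<in>Poly_Mapping.keys (entry F (Suc i) b c). mdeg m + shift F i b = shift F (Suc i) c)) \<and>
     (\<forall>i. {v \<in> tensor_chains F (carrier (poly_ring n)) (Suc i). differential F (Suc i) v = 0}
        = differential F (Suc (Suc i)) ` tensor_chains F (carrier (poly_ring n)) (Suc (Suc i))) \<and>
     (\<exists>e. (\<exists>b\<in>basis F 0. e b \<noteq> 0) \<and> (\<forall>b\<in>basis F 0. e b \<noteq> 0 \<longrightarrow> shift F 0 b = 0) \<and>
        {v \<in> tensor_chains F (carrier (poly_ring n)) 0. (\<Sum>b\<in>basis F 0. e b * Poly_Mapping.lookup (v b) 0) = 0}
        = differential F 1 ` tensor_chains F (carrier (poly_ring n)) 1)"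

definition chain_scale :: "'k::field \<Rightarrow> ('b \<Rightarrow> 'k mpoly) \<Rightarrow> ('b \<Rightarrow> 'k mpoly)" where
  "chain_scale a v = (\<lambda>b. Poly_Mapping.single 0 a * v b)"

interpretation chain_space: vector_space chain_scale
  by standard
    (simp_all add: chain_scale_def fun_eq_iff algebra_simps single_add mult_single
      flip: mult.assoc)

text \<open>\<open>dim_K H_i(F \<otimes> I)_j\<close>. The boundaries form a subspace of the finite-dimensional space of
  cycles, so the dimension of the quotient is the difference of the dimensions.\<close>

definition tensor_homology_dim ::
    "('b, 'k::field) graded_complex \<Rightarrow> 'k mpoly set \<Rightarrow> nat \<Rightarrow> nat \<Rightarrow> nat" where
  "tensor_homology_dim F I i j =
     chain_space.dim {v \<in> tensor_chains_deg F I i j. differential F i v = 0}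
   - chain_space.dim (differential F (Suc i) ` tensor_chains_deg F I (Suc i) j)"

section \<open>Graded Betti numbers\<close>

text \<open>The Koszul complex of \<open>x_1, \<dots>, x_n\<close>: the subset \<open>{t_1 < \<dots> < t_i}\<close> of \<open>{1..n}\<close> stands for
  the basis element \<open>e_(t_1) \<and> \<dots> \<and> e_(t_i)\<close>.\<close>

definition koszul :: "nat \<Rightarrow> (nat set, 'k::field) graded_complex" where
  "koszul n = \<lparr>
     basis = (\<lambda>i. {\<sigma>. \<sigma> \<subseteq> {1..n} \<and> card \<sigma> = i}),
     shift = (\<lambda>i \<sigma>. i),
     entry = (\<lambda>i \<tau> \<sigma>. \<Sum>t | t \<in> \<sigma> \<and> \<tau> = \<sigma> - {t}. (-1) ^ card {s\<in>\<sigma>. s < t} * var_poly t)\<rparr>"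

text \<open>\<open>\<beta>_(i,j)(I) = dim_K Tor_i(K, I)_j\<close>, where \<open>Tor_i(K, I) = H_i(F \<otimes> I)\<close> is formed with
  the Koszul complex as graded free resolution \<open>F\<close> of \<open>K\<close>. That the Koszul complex is such a
  resolution is proved at the end of this theory.\<close>

definition graded_betti :: "nat \<Rightarrow> 'k::field mpoly set \<Rightarrow> nat \<Rightarrow> nat \<Rightarrow> nat" where
  "graded_betti n I i j = tensor_homology_dim (koszul n) I i j"

definition is_corner :: "nat \<Rightarrow> 'k::field mpoly set \<Rightarrow> nat \<Rightarrow> nat \<Rightarrow> bool" where
  "is_corner n I k l \<longleftrightarrow>
     graded_betti n I k (k + l) \<noteq> 0 \<and>
     (\<forall>i j. i \<ge> k \<and> j \<ge> l \<and> (i, j) \<noteq> (k, l) \<longrightarrow> graded_betti n I i (i + j) = 0)"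

section \<open>The polynomial ring is a ring\<close>

lemma carrier_poly_ring: "carrier (poly_ring n) = {p :: 'k::field mpoly. \<forall>m\<in>Poly_Mapping.keys p. Poly_Mapping.keys m \<subseteq> {1..n}}"
  by (auto simp: poly_ring_def monomials_def)

lemma keys_monomial_add: "Poly_Mapping.keys (a + b) = Poly_Mapping.keys a \<union> Poly_Mapping.keys (b :: monomial)"
  by (auto simp: lookup_add in_keys_iff)

lemma cring_poly_ring: "cring (poly_ring n :: 'k::field mpoly ring)"
proof -
  have add: "p + q \<in> carrier (poly_ring n)"
    if "p \<in> carrier (poly_ring n)" "q \<in> carrier (poly_ring n)" for p q :: "'k mpoly"
    using that Poly_Mapping.keys_add[of p q] by (fastforce simp: carrier_poly_ring)
  have mult: "p * q \<in> carrier (poly_ring n)"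
    if "p \<in> carrier (poly_ring n)" "q \<in> carrier (poly_ring n)" for p q :: "'k mpoly"
  proof -
    have "Poly_Mapping.keys m \<subseteq> {1..n}" if m: "m \<in> Poly_Mapping.keys (p * q)" for m
    proof -
      obtain a b where "m = a + b" "a \<in> Poly_Mapping.keys p" "b \<in> Poly_Mapping.keys q"
        using m keys_mult[of p q] by blast
      then show ?thesis
        using \<open>p \<in> _\<close> \<open>q \<in> _\<close> by (auto simp: carrier_poly_ring keys_monomial_add)
    qed
    then show ?thesis by (auto simp: carrier_poly_ring)
  qed
  have one: "(1 :: 'k mpoly) \<in> carrier (poly_ring n)"
    by (auto simp: carrier_poly_ring in_keys_iff lookup_one when_def split: if_splits)
  have uminus: "- p \<in> carrier (poly_ring n)" if "p \<in> carrier (poly_ring n)" for p :: "'k mpoly"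
    using that by (auto simp: carrier_poly_ring in_keys_iff)
  show ?thesis
  proof (rule cringI)
    show "abelian_group (poly_ring n :: 'k mpoly ring)"
    proof (rule abelian_groupI)
      fix x :: "'k mpoly" assume "x \<in> carrier (poly_ring n)"
      then show "\<exists>y\<in>carrier (poly_ring n). y \<oplus>\<^bsub>poly_ring n\<^esub> x = \<zero>\<^bsub>poly_ring n\<^esub>"
        using uminus[of x] by (intro bexI[of _ "- x"]) (auto simp: poly_ring_def)
    qed (use add in \<open>auto simp: poly_ring_def add_ac\<close>)
    show "comm_monoid (poly_ring n :: 'k mpoly ring)"
      by (rule comm_monoidI) (use mult one in \<open>auto simp: poly_ring_def mult_ac\<close>)
  qed (auto simp: poly_ring_def algebra_simps)
qed

section \<open>The Koszul complex is a graded free resolution of the field\<close>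

lemma lookup_var_poly_mult:
  fixes p :: "'k::field mpoly"
  shows "Poly_Mapping.lookup (var_poly t * p) a =
    (if Poly_Mapping.lookup a t = 0 then 0
     else Poly_Mapping.lookup p (a - Poly_Mapping.single t 1))"
proof -
  let ?m = "Poly_Mapping.single t 1 :: monomial"
  have "Poly_Mapping.lookup (var_poly t * p) a = (\<Sum>q. Poly_Mapping.lookup p q when a = ?m + q)"
    by (simp add: lookup_mult var_poly_def monom_poly_def lookup_single when_mult)
  also have "\<dots> = (if Poly_Mapping.lookup a t = 0 then 0 else Poly_Mapping.lookup p (a - ?m))"
  proof (cases "Poly_Mapping.lookup a t = 0")
    case True
    then have "a \<noteq> ?m + q" for q by (auto simp: lookup_add)
    then show ?thesis using True by simp
  next
    case False
    have "a = ?m + (a - ?m)"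
      using False by (intro poly_mapping_eqI) (auto simp: lookup_add lookup_minus lookup_single when_def)
    then have "(a = ?m + q) = (q = a - ?m)" for q
      by (metis add_diff_cancel_left')
    then show ?thesis using False by simp
  qed
  finally show ?thesis .
qed

lemma lookup_sign_mult:
  "Poly_Mapping.lookup ((-1) ^ c * p) a = (-1) ^ c * Poly_Mapping.lookup (p :: 'k::field mpoly) a"
  by (cases "even c") simp_all

lemma differential_koszul:
  "differential (koszul n :: (nat set, 'k::field) graded_complex) (Suc i) v \<tau> =
    (if \<tau> \<subseteq> {1..n} \<and> card \<tau> = i
     then \<Sum>t\<in>{1..n} - \<tau>. (-1) ^ card {s\<in>\<tau>. s < t} * var_poly t * v (insert t \<tau>) else 0)"
proof (cases "\<tau> \<subseteq> {1..n} \<and> card \<tau> = i")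
  case True
  then have fin: "finite \<tau>" using finite_subset by blast
  let ?B = "{\<sigma>. \<sigma> \<subseteq> {1..n} \<and> card \<sigma> = Suc i}"
  have finB: "finite ?B" by simp
  have fin': "finite {t. t \<in> \<sigma> \<and> \<tau> = \<sigma> - {t}}" if "\<sigma> \<in> ?B" for \<sigma>
  proof (rule finite_subset)
    show "{t. t \<in> \<sigma> \<and> \<tau> = \<sigma> - {t}} \<subseteq> {1..n}" using that by auto
  qed simp
  have "differential (koszul n) (Suc i) v \<tau> =
    (\<Sum>\<sigma>\<in>?B. \<Sum>t | t \<in> \<sigma> \<and> \<tau> = \<sigma> - {t}. (-1) ^ card {s\<in>\<sigma>. s < t} * var_poly t * v \<sigma>)"
    using True by (simp add: differential_def koszul_def sum_distrib_right)
  also have "\<dots> = (\<Sum>(\<sigma>, t)\<in>(SIGMA \<sigma>:?B. {t. t \<in> \<sigma> \<and> \<tau> = \<sigma> - {t}}).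
      (-1) ^ card {s\<in>\<sigma>. s < t} * var_poly t * v \<sigma>)"
    using finB fin' by (intro sum.Sigma ballI)
  also have "\<dots> = (\<Sum>t\<in>{1..n} - \<tau>. (-1) ^ card {s\<in>\<tau>. s < t} * var_poly t * v (insert t \<tau>))"
  proof (rule sum.reindex_bij_witness[where i = "\<lambda>t. (insert t \<tau>, t)" and j = snd], goal_cases)
    case (1 x) then show ?case by (cases x) auto
  next
    case (2 x)
    obtain \<sigma> t where x: "x = (\<sigma>, t)" by (cases x)
    have "\<sigma> \<subseteq> {1..n}" "t \<in> \<sigma>" "\<tau> = \<sigma> - {t}" using 2 by (simp_all add: x)
    then show ?case unfolding x by (simp add: subset_iff)
  next
    case (3 t) then show ?case by simp
  next
    case (4 t) then show ?case using True fin by auto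
  next
    case (5 x)
    obtain \<sigma> t where x: "x = (\<sigma>, t)" by (cases x)
    have "{s\<in>\<sigma>. s < t} = {s\<in>\<tau>. s < t}" "insert t \<tau> = \<sigma>" using 5 x by auto
    then show ?case by (simp add: x)
  qed
  finally show ?thesis using True by simp
qed (auto simp: differential_def koszul_def)

lemma lookup_differential_koszul:
  "Poly_Mapping.lookup (differential (koszul n :: (nat set, 'k::field) graded_complex) (Suc i) v \<tau>) a =
    (if \<tau> \<subseteq> {1..n} \<and> card \<tau> = i
     then \<Sum>t\<in>{1..n} - \<tau>. (-1) ^ card {s\<in>\<tau>. s < t} *
       (if Poly_Mapping.lookup a t = 0 then 0
        else Poly_Mapping.lookup (v (insert t \<tau>)) (a - Poly_Mapping.single t 1)) else 0)"
  by (simp add: differential_koszul lookup_sum lookup_sign_mult lookup_var_poly_mult mult.assoc)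

lemma sign_swap:
  fixes s t :: nat
  assumes "finite \<tau>" "s \<notin> \<tau>" "t \<notin> \<tau>" "s \<noteq> t"
  shows "(-1) ^ card {r\<in>\<tau>. r < s} * (-1) ^ card {r\<in>insert s \<tau>. r < t} =
     - ((-1) ^ card {r\<in>\<tau>. r < t} * (-1) ^ card {r\<in>insert t \<tau>. r < s} :: 'a::comm_ring_1)"
proof -
  have ins: "card {r\<in>insert x \<tau>. r < y} = (if x < y then Suc else id) (card {r\<in>\<tau>. r < y})"
    if "x \<notin> \<tau>" for x y
  proof -
    have "{r\<in>insert x \<tau>. r < y} = (if x < y then insert x else id) {r\<in>\<tau>. r < y}" by auto
    then show ?thesis using that assms(1) by simp
  qed
  show ?thesis
    using assms(4) unfolding ins[OF assms(2)] ins[OF assms(3)] by (cases "s < t") auto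
qed

lemma differential_koszul_differential_koszul:
  "differential (koszul n :: (nat set, 'k::field) graded_complex) (Suc i)
     (differential (koszul n) (Suc (Suc i)) v) = 0"
proof
  fix \<tau>
  let ?K = "koszul n :: (nat set, 'k) graded_complex"
  show "differential ?K (Suc i) (differential ?K (Suc (Suc i)) v) \<tau> = 0 \<tau>"
  proof (cases "\<tau> \<subseteq> {1..n} \<and> card \<tau> = i")
    case True
    then have fin: "finite \<tau>" using finite_subset by blast
    define g where "g = (\<lambda>s t. (-1) ^ card {r\<in>\<tau>. r < s} * (-1) ^ card {r\<in>insert s \<tau>. r < t} *
       (var_poly s * var_poly t * v (insert s (insert t \<tau>))))"
    have anti: "g s t = - g t s" if "s \<notin> \<tau>" "t \<notin> \<tau>" "s \<noteq> t" for s t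
      unfolding g_def sign_swap[OF fin that] by (simp add: insert_commute mult_ac)
    let ?A = "{1..n} - \<tau>"
    have "differential ?K (Suc i) (differential ?K (Suc (Suc i)) v) \<tau> =
      (\<Sum>s\<in>?A. (-1) ^ card {r\<in>\<tau>. r < s} * var_poly s *
        (\<Sum>t\<in>{1..n} - insert s \<tau>. (-1) ^ card {r\<in>insert s \<tau>. r < t} * var_poly t *
            v (insert t (insert s \<tau>))))"
      using True fin by (simp add: differential_koszul)
    also have "\<dots> = (\<Sum>s\<in>?A. \<Sum>t\<in>?A - {s}. g s t)"
      unfolding sum_distrib_left g_def
      by (intro sum.cong) (auto simp: insert_commute mult_ac)
    also have "\<dots> = (\<Sum>s\<in>?A. \<Sum>t\<in>?A. if t = s then 0 else g s t)"
      by (intro sum.cong refl sum.mono_neutral_cong_left) auto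
    also have "\<dots> = 0"
    proof -
      let ?h = "\<lambda>s t. if t = s then 0 else g s t"
      have split: "?h s t = (if s < t then g s t else 0) + (if t < s then g s t else 0)" for s t
        by auto
      have "(\<Sum>s\<in>?A. \<Sum>t\<in>?A. ?h s t) =
        (\<Sum>s\<in>?A. \<Sum>t\<in>?A. if s < t then g s t else 0) + (\<Sum>s\<in>?A. \<Sum>t\<in>?A. if t < s then g s t else 0)"
        unfolding split by (simp only: sum.distrib)
      also have "(\<Sum>s\<in>?A. \<Sum>t\<in>?A. if t < s then g s t else 0) =
          (\<Sum>t\<in>?A. \<Sum>s\<in>?A. if t < s then g s t else 0)"
        by (rule sum.swap)
      also have "\<dots> = (\<Sum>t\<in>?A. \<Sum>s\<in>?A. - (if t < s then g t s else 0))"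
      proof (intro sum.cong refl)
        fix s t assume "t \<in> ?A" "s \<in> ?A"
        then show "(if t < s then g s t else 0) = - (if t < s then g t s else 0)"
          using anti[of s t] by auto
      qed
      finally show ?thesis by (simp add: sum_negf)
    qed
    finally show ?thesis by simp
  next
    case False
    then show ?thesis unfolding differential_koszul by auto
  qed
qed

text \<open>The multigraded contracting homotopy: \<open>x^a e_\<sigma>\<close> is sent to \<open>x^(a - t) e_(\<sigma> \<union> {t})\<close> with \<open>t\<close>
  the least element of \<open>supp a \<union> \<sigma>\<close> if this is not in \<open>\<sigma>\<close>, and to 0 otherwise.\<close>

lemma koszul_homotopy:
  fixes n :: nat and v :: "nat set \<Rightarrow> 'k::field mpoly"
  defines "K \<equiv> koszul n :: (nat set, 'k) graded_complex"
    and "S \<equiv> carrier (poly_ring n) :: 'k mpoly set"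
  assumes v: "v \<in> tensor_chains K S i"
    and cyc: "i = 0 \<and> Poly_Mapping.lookup (v {}) 0 = 0 \<or> i \<noteq> 0 \<and> differential K i v = 0"
  shows "v \<in> differential K (Suc i) ` tensor_chains K S (Suc i)"
proof -
  note One_nat_def [simp del]
  let ?x = "\<lambda>t. Poly_Mapping.single t 1 :: monomial"
  let ?P = "\<lambda>\<rho> (a :: monomial). \<rho> \<subseteq> {1..n} \<and> card \<rho> = Suc i \<and> (\<forall>s\<in>Poly_Mapping.keys a. Min \<rho> \<le> s)"
  define f where "f \<rho> a = (if ?P \<rho> a then Poly_Mapping.lookup (v (\<rho> - {Min \<rho>})) (a + ?x (Min \<rho>)) else 0)"
    for \<rho> a
  define w where "w \<rho> = Abs_poly_mapping (f \<rho>)" for \<rho>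
  have finf: "finite {a. f \<rho> a \<noteq> 0}" for \<rho>
  proof (rule finite_subset)
    show "{a. f \<rho> a \<noteq> 0} \<subseteq> (\<lambda>a. a + ?x (Min \<rho>)) -` Poly_Mapping.keys (v (\<rho> - {Min \<rho>}))"
      by (auto simp: f_def in_keys_iff split: if_splits)
    show "finite \<dots>" by (rule finite_vimageI) (auto intro: injI)
  qed
  have w: "Poly_Mapping.lookup (w \<rho>) a = f \<rho> a" for \<rho> a
    unfolding w_def using finf by simp
  have vS: "v \<sigma> \<in> S" if "\<sigma> \<subseteq> {1..n}" "card \<sigma> = i" for \<sigma>
    using v that by (auto simp: tensor_chains_def K_def koszul_def)
  have v0: "v \<sigma> = 0" if "\<not> (\<sigma> \<subseteq> {1..n} \<and> card \<sigma> = i)" for \<sigma>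
    using v that by (auto simp: tensor_chains_def K_def koszul_def)
  have wS: "w \<rho> \<in> S" if \<rho>: "\<rho> \<subseteq> {1..n}" "card \<rho> = Suc i" for \<rho>
  proof -
    have "finite \<rho>" "\<rho> \<noteq> {}" using \<rho> finite_subset by auto
    then have "Min \<rho> \<in> \<rho>" by simp
    then have "card (\<rho> - {Min \<rho>}) = i" using \<rho> by simp
    moreover have "\<rho> - {Min \<rho>} \<subseteq> {1..n}" using \<rho> by auto
    ultimately have "v (\<rho> - {Min \<rho>}) \<in> S" by (intro vS)
    then have vn: "Poly_Mapping.keys b \<subseteq> {1..n}"
      if "b \<in> Poly_Mapping.keys (v (\<rho> - {Min \<rho>}))" for b
      using that by (simp add: S_def carrier_poly_ring)
    have "Poly_Mapping.keys a \<subseteq> {1..n}" if a: "a \<in> Poly_Mapping.keys (w \<rho>)" for a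
    proof -
      have "f \<rho> a \<noteq> 0" using a by (simp only: in_keys_iff w not_False_eq_True)
      then have "Poly_Mapping.lookup (v (\<rho> - {Min \<rho>})) (a + ?x (Min \<rho>)) \<noteq> 0"
        by (metis f_def)
      then have "Poly_Mapping.keys (a + ?x (Min \<rho>)) \<subseteq> {1..n}" by (intro vn) (simp only: in_keys_iff not_False_eq_True)
      then show ?thesis by (simp only: keys_monomial_add Un_subset_iff)
    qed
    then show ?thesis unfolding S_def carrier_poly_ring by blast
  qed
  have w0: "w \<rho> = 0" if "\<not> (\<rho> \<subseteq> {1..n} \<and> card \<rho> = Suc i)" for \<rho>
    using that by (intro poly_mapping_eqI) (auto simp: w f_def)
  have "w \<in> tensor_chains K S (Suc i)"
    using wS w0 by (auto simp: tensor_chains_def K_def koszul_def)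
  moreover have "v = differential K (Suc i) w"
  proof (intro ext poly_mapping_eqI)
    fix \<sigma> a
    show "Poly_Mapping.lookup (v \<sigma>) a = Poly_Mapping.lookup (differential K (Suc i) w \<sigma>) a"
    proof (cases "\<sigma> \<subseteq> {1..n} \<and> card \<sigma> = i \<and> Poly_Mapping.keys a \<subseteq> {1..n}")
      case False
      then consider "\<not> (\<sigma> \<subseteq> {1..n} \<and> card \<sigma> = i)"
        | "\<sigma> \<subseteq> {1..n}" "card \<sigma> = i" "\<not> Poly_Mapping.keys a \<subseteq> {1..n}" by blast
      then show ?thesis
      proof cases
        case 1
        then show ?thesis by (auto simp: v0 K_def differential_koszul)
      next
        case 2
        then obtain s where s: "s \<in> Poly_Mapping.keys a" "s \<notin> {1..n}" by blast
        have "Poly_Mapping.lookup (v \<sigma>) a = 0"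
          using vS[OF 2(1,2)] 2(3) unfolding S_def carrier_poly_ring by (metis (mono_tags) in_keys_iff mem_Collect_eq)
        moreover have "Poly_Mapping.lookup (w (insert t \<sigma>)) (a - ?x t) = 0" if t: "t \<in> {1..n} - \<sigma>" for t
        proof -
          have "w (insert t \<sigma>) \<in> S" using 2 t finite_subset[OF 2(1)] by (intro wS) auto
          moreover have "s \<in> Poly_Mapping.keys (a - ?x t)"
            using s t by (auto simp: in_keys_iff lookup_minus lookup_single when_def)
          ultimately have "a - ?x t \<notin> Poly_Mapping.keys (w (insert t \<sigma>))"
            using s unfolding S_def carrier_poly_ring by blast
          then show ?thesis by (simp only: in_keys_iff not_not)
        qed
        moreover from this have "(\<Sum>t\<in>{1..n} - \<sigma>. (-1) ^ card {s\<in>\<sigma>. s < t} *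
          (if Poly_Mapping.lookup a t = 0 then 0
           else Poly_Mapping.lookup (w (insert t \<sigma>)) (a - ?x t))) = (0 :: 'k)"
          by (intro sum.neutral ballI) simp
        ultimately show ?thesis
          unfolding K_def lookup_differential_koszul by (simp only: if_cancel)
      qed
    next
      case True
      then have fin: "finite \<sigma>" using finite_subset by blast
      define M where "M = \<sigma> \<union> Poly_Mapping.keys a"
      have finM: "finite M" and Mn: "M \<subseteq> {1..n}" using fin True by (auto simp: M_def)
      have d: "Poly_Mapping.lookup (differential K (Suc i) w \<sigma>) a =
        (\<Sum>t\<in>{1..n} - \<sigma>. (-1) ^ card {s\<in>\<sigma>. s < t} *
          (if Poly_Mapping.lookup a t = 0 then 0 else f (insert t \<sigma>) (a - ?x t)))"
        using True unfolding K_def lookup_differential_koszul w by simp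
      show ?thesis
      proof (cases "M = {}")
        case True
        then have "\<sigma> = {}" "a = 0" by (auto simp: M_def)
        then show ?thesis using \<open>\<sigma> \<subseteq> _ \<and> _\<close> cyc unfolding d by auto
      next
        case False
        define m where "m = Min M"
        have m: "m \<in> M" "\<And>s. s \<in> M \<Longrightarrow> m \<le> s" using finM False by (auto simp: m_def)
        have mn: "m \<in> {1..n}" using m Mn by auto
        show ?thesis
        proof (cases "m \<in> \<sigma>")
          case msig: False
          have "(\<Sum>t\<in>{1..n} - \<sigma>. (-1) ^ card {s\<in>\<sigma>. s < t} *
            (if Poly_Mapping.lookup a t = 0 then 0 else f (insert t \<sigma>) (a - ?x t))) =
            (\<Sum>t\<in>{1..n} - \<sigma>. if t = m then Poly_Mapping.lookup (v \<sigma>) a else 0)"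
          proof (rule sum.cong[OF refl])
            fix t assume t: "t \<in> {1..n} - \<sigma>"
            have ma: "m \<in> Poly_Mapping.keys a" using m msig by (auto simp: M_def)
            show "(-1) ^ card {s\<in>\<sigma>. s < t} *
              (if Poly_Mapping.lookup a t = 0 then 0 else f (insert t \<sigma>) (a - ?x t)) =
              (if t = m then Poly_Mapping.lookup (v \<sigma>) a else 0)"
            proof (cases "t = m")
              case True
              have e: "{s\<in>\<sigma>. s < t} = {}" using m True by (force simp: M_def)
              have Mi: "Min (insert t \<sigma>) = t"
                using m True fin by (intro Min_eqI) (auto simp: M_def)
              have ad: "a - ?x t + ?x t = a"
                using ma True by (intro poly_mapping_eqI)
                  (auto simp: lookup_add lookup_minus lookup_single when_def in_keys_iff)
              have ks: "Poly_Mapping.keys (a - ?x t) \<subseteq> Poly_Mapping.keys a"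
                by (auto simp: in_keys_iff lookup_minus)
              have "?P (insert t \<sigma>) (a - ?x t)"
                using t fin \<open>\<sigma> \<subseteq> {1..n} \<and> card \<sigma> = i \<and> _\<close> ks m(2) True unfolding Mi by (auto simp: M_def)
              then have "f (insert t \<sigma>) (a - ?x t) = Poly_Mapping.lookup (v \<sigma>) a"
                using t by (simp add: f_def Mi ad)
              then show ?thesis using ma True unfolding e by (simp add: in_keys_iff)
            next
              case False
              show ?thesis
              proof (cases "t \<in> Poly_Mapping.keys a")
                case True
                have "m < t" using m(2)[of t] True False by (auto simp: M_def)
                have "Min (insert t \<sigma>) \<in> insert t \<sigma>" using fin by (intro Min_in) auto
                then have "Min (insert t \<sigma>) \<noteq> m" "Min (insert t \<sigma>) \<in> M"
                  using msig True \<open>t \<noteq> m\<close> by (auto simp: M_def)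
                then have "m < Min (insert t \<sigma>)" using m(2) by (metis le_neq_implies_less)
                moreover have "m \<in> Poly_Mapping.keys (a - ?x t)"
                  using ma False by (auto simp: in_keys_iff lookup_minus lookup_single when_def)
                ultimately have "\<not> ?P (insert t \<sigma>) (a - ?x t)" by (meson not_le)
                then have "f (insert t \<sigma>) (a - ?x t) = 0" unfolding f_def by (rule if_not_P)
                then show ?thesis using False by simp
              qed (use False in \<open>auto simp: in_keys_iff\<close>)
            qed
          qed
          also have "\<dots> = Poly_Mapping.lookup (v \<sigma>) a" using mn msig by simp
          finally show ?thesis unfolding d by simp
        next
          case msig: True
          then obtain j where j: "i = Suc j" using True fin by (cases i) auto
          define \<tau> where "\<tau> = \<sigma> - {m}"
          have \<tau>: "\<sigma> = insert m \<tau>" "m \<notin> \<tau>" "\<tau> \<subseteq> {1..n}" "card \<tau> = j" "finite \<tau>"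
            using True msig fin j by (auto simp: \<tau>_def)
          have e0: "{s\<in>\<tau>. s < m} = {}" using m \<tau>(1) by (force simp: M_def)
          have fe: "f (insert t \<sigma>) (a - ?x t) =
             Poly_Mapping.lookup (v (insert t \<tau>)) (a + ?x m - ?x t)"
            if t: "t \<in> {1..n} - \<sigma>" "Poly_Mapping.lookup a t \<noteq> 0" for t
          proof -
            have tM: "t \<in> M" using t by (auto simp: M_def in_keys_iff)
            have "m \<noteq> t" using t msig by auto
            have Mi: "Min (insert t \<sigma>) = m"
              using m tM msig fin by (intro Min_eqI) (auto simp: M_def)
            have ks: "Poly_Mapping.keys (a - ?x t) \<subseteq> Poly_Mapping.keys a"
              by (auto simp: in_keys_iff lookup_minus)
            have "?P (insert t \<sigma>) (a - ?x t)"
              using t fin True ks m(2) unfolding Mi by (auto simp: M_def)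
            moreover have "insert t \<sigma> - {m} = insert t \<tau>" using \<tau> \<open>m \<noteq> t\<close> by auto
            moreover have "a - ?x t + ?x m = a + ?x m - ?x t"
              using t(2) \<open>m \<noteq> t\<close> by (intro poly_mapping_eqI)
                (auto simp: lookup_add lookup_minus lookup_single when_def)
            ultimately show ?thesis by (simp add: f_def Mi)
          qed
          let ?g = "\<lambda>t. (-1) ^ card {s\<in>\<tau>. s < t} * (if Poly_Mapping.lookup (a + ?x m) t = 0 then 0
             else Poly_Mapping.lookup (v (insert t \<tau>)) (a + ?x m - ?x t))"
          have "0 = Poly_Mapping.lookup (differential K (Suc j) v \<tau>) (a + ?x m)"
            using cyc j by simp
          also have "\<dots> = (\<Sum>t\<in>{1..n} - \<tau>. ?g t)"
            using \<tau> by (simp add: K_def lookup_differential_koszul)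
          also have "{1..n} - \<tau> = insert m ({1..n} - \<sigma>)" using \<tau> mn by auto
          also have "(\<Sum>t\<in>insert m ({1..n} - \<sigma>). ?g t) = ?g m + (\<Sum>t\<in>{1..n} - \<sigma>. ?g t)"
            using msig by simp
          also have "?g m = Poly_Mapping.lookup (v \<sigma>) a"
            unfolding e0 \<tau>(1) by (simp add: lookup_add)
          also have "(\<Sum>t\<in>{1..n} - \<sigma>. ?g t) = - (\<Sum>t\<in>{1..n} - \<sigma>. (-1) ^ card {s\<in>\<sigma>. s < t} *
            (if Poly_Mapping.lookup a t = 0 then 0 else f (insert t \<sigma>) (a - ?x t)))"
            unfolding sum_negf[symmetric]
          proof (rule sum.cong[OF refl])
            fix t assume t: "t \<in> {1..n} - \<sigma>"
            then have "m \<noteq> t" using msig by auto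
            then have la: "Poly_Mapping.lookup (a + ?x m) t = Poly_Mapping.lookup a t"
              by (simp add: lookup_add lookup_single)
            show "?g t = - ((-1) ^ card {s\<in>\<sigma>. s < t} *
              (if Poly_Mapping.lookup a t = 0 then 0 else f (insert t \<sigma>) (a - ?x t)))"
            proof (cases "Poly_Mapping.lookup a t = 0")
              case False
              then have "m < t" using m(2)[of t] \<open>m \<noteq> t\<close> by (auto simp: M_def in_keys_iff)
              then have "{s\<in>\<sigma>. s < t} = insert m {s\<in>\<tau>. s < t}" using \<tau>(1) by auto
              then have "card {s\<in>\<sigma>. s < t} = Suc (card {s\<in>\<tau>. s < t})" using \<tau> by simp
              then show ?thesis using fe[OF t False] False la by simp
            qed (simp add: la)
          qed
          finally show ?thesis unfolding d by simp
        qed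
      qed
    qed
  qed
  ultimately show ?thesis by blast
qed

lemma sign_var_in_poly_ring:
  "t \<in> {1..n} \<Longrightarrow> (-1) ^ c * var_poly t \<in> carrier (poly_ring n :: 'k::field mpoly ring)"
  by (cases "even c")
    (auto simp: carrier_poly_ring var_poly_def monom_poly_def in_keys_iff lookup_single when_def split: if_splits)

lemma differential_koszul_in_chains:
  fixes v :: "nat set \<Rightarrow> 'k::field mpoly"
  assumes I: "ideal I (poly_ring n)" and v: "v \<in> tensor_chains (koszul n) I (Suc i)"
  shows "differential (koszul n) (Suc i) v \<in> tensor_chains (koszul n) I i"
proof -
  interpret I: ideal I "poly_ring n" by fact
  have add: "p + q \<in> I" if "p \<in> I" "q \<in> I" for p q
    using additive_subgroup.a_closed[OF I.additive_subgroup_axioms that] by (simp add: poly_ring_def)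
  have zero: "0 \<in> I" using additive_subgroup.zero_closed[OF I.additive_subgroup_axioms] by (simp add: poly_ring_def)
  have sum: "(\<Sum>x\<in>A. h x) \<in> I" if "\<And>x. x \<in> A \<Longrightarrow> h x \<in> I" for A :: "nat set" and h
    using that by (induction A rule: infinite_finite_induct) (auto intro: add zero)
  have mult: "c * p \<in> I" if "c \<in> carrier (poly_ring n)" "p \<in> I" for c p
    using I.I_l_closed[OF that(2,1)] by (simp add: poly_ring_def)
  have vI: "v \<sigma> \<in> I" if "\<sigma> \<subseteq> {1..n}" "card \<sigma> = Suc i" for \<sigma>
    using v that by (auto simp: tensor_chains_def koszul_def)
  have "differential (koszul n) (Suc i) v \<tau> \<in> I" if \<tau>: "\<tau> \<subseteq> {1..n}" "card \<tau> = i" for \<tau>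
  proof -
    have "(-1) ^ card {s\<in>\<tau>. s < t} * var_poly t * v (insert t \<tau>) \<in> I" if "t \<in> {1..n} - \<tau>" for t
      using that \<tau> finite_subset[OF \<tau>(1)] by (intro mult sign_var_in_poly_ring vI) simp_all
    then show ?thesis unfolding differential_koszul if_P[OF conjI[OF \<tau>]] by (rule sum)
  qed
  moreover have "differential (koszul n) (Suc i) v \<tau> = 0" if "\<not> (\<tau> \<subseteq> {1..n} \<and> card \<tau> = i)" for \<tau>
    unfolding differential_koszul using that by auto
  ultimately show ?thesis unfolding tensor_chains_def by (simp add: koszul_def)
qed

theorem koszul_resolution:
  "graded_free_resolution_of_field n (koszul n :: (nat set, 'k::field) graded_complex)"
proof -
  let ?K = "koszul n :: (nat set, 'k) graded_complex"
  let ?S = "carrier (poly_ring n) :: 'k mpoly set"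
  interpret R: cring "poly_ring n :: 'k mpoly ring" by (rule cring_poly_ring)
  have bas: "basis ?K i = {\<sigma>. \<sigma> \<subseteq> {1..n} \<and> card \<sigma> = i}" for i by (simp add: koszul_def)
  have b0: "basis ?K 0 = {{}}" unfolding bas using finite_subset by fastforce
  have entry: "entry ?K (Suc i) \<tau> \<sigma> \<in> ?S \<and>
      (\<forall>m\<in>Poly_Mapping.keys (entry ?K (Suc i) \<tau> \<sigma>). mdeg m + shift ?K i \<tau> = shift ?K (Suc i) \<sigma>)"
    if "\<tau> \<in> basis ?K i" "\<sigma> \<in> basis ?K (Suc i)" for i \<tau> \<sigma>
  proof -
    define T where "T = {t. t \<in> \<sigma> \<and> \<tau> = \<sigma> - {t}}"
    have e: "entry ?K (Suc i) \<tau> \<sigma> = (\<Sum>t\<in>T. (-1) ^ card {s\<in>\<sigma>. s < t} * var_poly t)"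
      by (simp add: koszul_def T_def)
    have sh: "shift ?K i \<tau> = i" "shift ?K (Suc i) \<sigma> = Suc i" by (simp_all add: koszul_def)
    consider "T = {}" | t where "T = {t}" "t \<in> \<sigma>" by (auto simp: T_def)
    then show ?thesis
    proof cases
      case 1
      then show ?thesis by (simp add: e carrier_poly_ring)
    next
      case 2
      have "t \<in> {1..n}" using 2 that by (auto simp: bas)
      moreover have "mdeg m = 1"
        if "m \<in> Poly_Mapping.keys ((-1) ^ c * var_poly t :: 'k mpoly)" for m c
        using that by (cases "even c")
          (auto simp: var_poly_def monom_poly_def in_keys_iff lookup_single when_def mdeg_def split: if_splits)
      ultimately show ?thesis using sign_var_in_poly_ring[of t n] 2 by (auto simp: e sh)
    qed
  qed
  have S: "ideal ?S (poly_ring n)" by (rule R.oneideal)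
  have ex: "{v \<in> tensor_chains ?K ?S (Suc i). differential ?K (Suc i) v = 0}
      = differential ?K (Suc (Suc i)) ` tensor_chains ?K ?S (Suc (Suc i))" for i
  proof (intro equalityI subsetI)
    fix v assume "v \<in> {v \<in> tensor_chains ?K ?S (Suc i). differential ?K (Suc i) v = 0}"
    then show "v \<in> differential ?K (Suc (Suc i)) ` tensor_chains ?K ?S (Suc (Suc i))"
      by (intro koszul_homotopy) simp_all
  next
    fix v assume "v \<in> differential ?K (Suc (Suc i)) ` tensor_chains ?K ?S (Suc (Suc i))"
    then obtain w where "v = differential ?K (Suc (Suc i)) w" "w \<in> tensor_chains ?K ?S (Suc (Suc i))"
      by (rule imageE)
    then show "v \<in> {v \<in> tensor_chains ?K ?S (Suc i). differential ?K (Suc i) v = 0}"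
      by (simp add: differential_koszul_in_chains[OF S] differential_koszul_differential_koszul)
  qed
  have aug: "{v \<in> tensor_chains ?K ?S 0. (\<Sum>b\<in>basis ?K 0. 1 * Poly_Mapping.lookup (v b) 0) = 0}
      = differential ?K 1 ` tensor_chains ?K ?S 1"
  proof -
    have "Poly_Mapping.lookup (differential ?K (Suc 0) w {}) 0 = 0" for w
      by (simp add: lookup_differential_koszul)
    then show ?thesis
      using koszul_homotopy[of _ n 0] differential_koszul_in_chains[OF S, of _ 0]
      by (intro equalityI subsetI) (auto simp: b0)
  qed
  have "\<exists>e. (\<exists>b\<in>basis ?K 0. e b \<noteq> 0) \<and> (\<forall>b\<in>basis ?K 0. e b \<noteq> 0 \<longrightarrow> shift ?K 0 b = 0) \<and>
        {v \<in> tensor_chains ?K ?S 0. (\<Sum>b\<in>basis ?K 0. e b * Poly_Mapping.lookup (v b) 0) = 0}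
        = differential ?K 1 ` tensor_chains ?K ?S 1"
    using aug by (intro exI[of _ "\<lambda>_. 1"] conjI) (simp_all add: b0, simp add: koszul_def)
  moreover have "finite (basis ?K i)" for i by (simp add: bas)
  ultimately show ?thesis
    unfolding graded_free_resolution_of_field_def by (intro conjI allI ballI ex) (use entry in blast)+
qed

end

theory Submission
  imports Defs "HOL-Library.Nat_Bijection"
begin

text \<open>The Koszul complex of a squarefree monomial ideal is exact in nonsquarefree multidegrees,
  hence in degrees above \<open>n\<close>, so that every corner satisfies \<open>k + l \<le> n\<close>; strict monotonicity of the two
  sequences gives the reverse inequality. Conversely, in a squarefree
  lexsegment ideal, a minimal generator of degree \<open>c\<close> that is divisible by \<open>x_n\<close>
  gives a nonzero Tor class in homological degree \<open>n - c\<close> and internal degree \<open>n\<close>, which is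
  therefore extremal. An ideal with such a generator \<open>u_c\<close> in every degree \<open>l_1 \<le> c < n\<close> is obtained by
  reading squarefree monomials as binary words: it is enough that the \<open>u_c\<close> have \<open>c\<close> ones, end in 1 and
  are decreasing as numbers, since a monomial is then in the ideal iff its number is at least
  that of some \<open>u_c\<close> of at most its degree.\<close>

section \<open>Squarefree monomial ideals in terms of supports\<close>

text \<open>A predicate on supports lets an ideal be given by a condition instead of generators. If
  \<open>Q\<close> passes to larger subsets of \<open>{1..n}\<close>, this is a squarefree monomial
  ideal.\<close>

definition support_ideal :: "nat \<Rightarrow> (nat set \<Rightarrow> bool) \<Rightarrow> 'k::field mpoly set" where
  "support_ideal n Q = {p. \<forall>m\<in>Poly_Mapping.keys p. Poly_Mapping.keys m \<subseteq> {1..n} \<and> Q (Poly_Mapping.keys m)}"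

lemma support_ideal_subset_carrier: "support_ideal n Q \<subseteq> carrier (poly_ring n)"
  by (auto simp: support_ideal_def carrier_poly_ring)

text \<open>Divisibility by a squarefree monomial depends only on supports, so the right side is an
  ideal containing the generators. Conversely, its elements are built up term by term, each term
  being a multiple of a generator.\<close>

lemma genideal_eq_support_ideal:
  assumes G: "G \<subseteq> squarefree_monomials n"
  shows "Idl\<^bsub>poly_ring n\<^esub> (monom_poly ` G :: 'k::field mpoly set) =
    support_ideal n (\<lambda>A. \<exists>g\<in>G. Poly_Mapping.keys g \<subseteq> A)"
proof -
  interpret R: cring "poly_ring n :: 'k mpoly ring" by (rule cring_poly_ring)
  let ?P = "\<lambda>m. Poly_Mapping.keys m \<subseteq> {1..n} \<and> (\<exists>g\<in>G. Poly_Mapping.keys g \<subseteq> Poly_Mapping.keys m)"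
  define J where "J = {p :: 'k mpoly. \<forall>m\<in>Poly_Mapping.keys p. ?P m}"
  have GJ: "monom_poly ` G \<subseteq> J"
    using G by (fastforce simp: J_def monom_poly_def squarefree_monomials_def monomials_def)
  have Jc: "J \<subseteq> carrier (poly_ring n)" by (auto simp: J_def carrier_poly_ring)
  then have Gc: "monom_poly ` G \<subseteq> carrier (poly_ring n :: 'k mpoly ring)" using GJ by blast
  have mult: "x * a \<in> J" if "a \<in> J" "x \<in> carrier (poly_ring n)" for a x
  proof -
    have "?P m" if m: "m \<in> Poly_Mapping.keys (x * a)" for m
    proof -
      obtain b c where bc: "m = b + c" "b \<in> Poly_Mapping.keys x" "c \<in> Poly_Mapping.keys a"
        using m keys_mult[of x a] by blast
      have k: "Poly_Mapping.keys m = Poly_Mapping.keys b \<union> Poly_Mapping.keys c"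
        using bc(1) by (simp only: keys_monomial_add)
      have "?P c" "Poly_Mapping.keys b \<subseteq> {1..n}"
        using \<open>a \<in> J\<close> \<open>x \<in> _\<close> bc by (auto simp only: J_def carrier_poly_ring)
      then show ?thesis unfolding k by blast
    qed
    then show ?thesis by (simp add: J_def)
  qed
  have minus: "- p \<in> J" if "p \<in> J" for p using that by (auto simp: J_def in_keys_iff)
  have inv: "\<ominus>\<^bsub>poly_ring n\<^esub> p = - p" if "p \<in> J" for p
    using that minus[OF that] Jc by (intro R.minus_equality) (auto simp: poly_ring_def)
  have J: "ideal J (poly_ring n)"
  proof (rule idealI)
    show "ring (poly_ring n :: 'k mpoly ring)" by (rule R.ring_axioms)
    show "subgroup J (add_monoid (poly_ring n))"
    proof
      show "J \<subseteq> carrier (add_monoid (poly_ring n))" using Jc by simp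
      show "x \<otimes>\<^bsub>add_monoid (poly_ring n)\<^esub> y \<in> J" if "x \<in> J" "y \<in> J" for x y
        using that Poly_Mapping.keys_add[of x y] by (fastforce simp: J_def poly_ring_def)
      show "\<one>\<^bsub>add_monoid (poly_ring n)\<^esub> \<in> J" by (simp add: J_def poly_ring_def)
      show "inv\<^bsub>add_monoid (poly_ring n)\<^esub> x \<in> J" if "x \<in> J" for x
        using inv[OF that] minus[OF that] by (simp add: a_inv_def)
    qed
    show "x \<otimes>\<^bsub>poly_ring n\<^esub> a \<in> J" "a \<otimes>\<^bsub>poly_ring n\<^esub> x \<in> J"
      if "a \<in> J" "x \<in> carrier (poly_ring n)" for a x
      using mult[OF that] by (simp_all add: poly_ring_def mult.commute)
  qed
  interpret I: ideal "Idl\<^bsub>poly_ring n\<^esub> (monom_poly ` G)" "poly_ring n :: 'k mpoly ring"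
    by (rule R.genideal_ideal[OF Gc])
  have "p \<in> Idl\<^bsub>poly_ring n\<^esub> (monom_poly ` G)" if "p \<in> J" for p
    using that
  proof (induction p rule: Poly_Mapping.update_induct)
    case const
    show ?case using additive_subgroup.zero_closed[OF I.additive_subgroup_axioms] by (simp add: poly_ring_def)
  next
    case (update f a b)
    have u: "Poly_Mapping.update a b f = Poly_Mapping.single a b + f"
      using update.hyps by (intro poly_mapping_eqI) (auto simp: update.rep_eq lookup_add lookup_single in_keys_iff when_def)
    have "f \<in> J" "?P a"
      using update by (auto simp: J_def in_keys_iff Poly_Mapping.update.rep_eq split: if_splits)
    then obtain g where g: "g \<in> G" "Poly_Mapping.keys g \<subseteq> Poly_Mapping.keys a" by blast
    \<comment> \<open>The exponents of \<open>g\<close> are at most 1 and its support lies in that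
      of \<open>a\<close>, so \<open>g\<close> divides \<open>a\<close> and the truncated difference
      \<open>a - g\<close> is exact.\<close>
    have "Poly_Mapping.lookup g i \<le> Poly_Mapping.lookup a i" for i
    proof (cases "i \<in> Poly_Mapping.keys a")
      case True
      then have "1 \<le> Poly_Mapping.lookup a i" by (simp add: in_keys_iff)
      moreover have "Poly_Mapping.lookup g i \<le> 1" using G g(1) by (auto simp: squarefree_monomials_def)
      ultimately show ?thesis by simp
    next
      case False
      then have "i \<notin> Poly_Mapping.keys g" using g(2) by blast
      then show ?thesis by (simp add: in_keys_iff)
    qed
    then have "a = (a - g) + g"
      by (intro poly_mapping_eqI) (simp add: lookup_add lookup_minus)
    then have s: "Poly_Mapping.single a b = Poly_Mapping.single (a - g) b * monom_poly g"
      by (simp add: monom_poly_def mult_single)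
    have "Poly_Mapping.keys (a - g) \<subseteq> Poly_Mapping.keys a" by (auto simp: in_keys_iff lookup_minus)
    then have "Poly_Mapping.single (a - g) b \<in> carrier (poly_ring n)"
      using \<open>?P a\<close> by (auto simp: carrier_poly_ring split: if_splits)
    moreover have "(monom_poly g :: 'k mpoly) \<in> Idl\<^bsub>poly_ring n\<^esub> (monom_poly ` G)"
      by (rule subsetD[OF R.genideal_self[OF Gc] imageI[OF g(1)]])
    ultimately have aI: "Poly_Mapping.single a b \<in> Idl\<^bsub>poly_ring n\<^esub> (monom_poly ` G)"
      unfolding s using I.I_l_closed[of "monom_poly g" "Poly_Mapping.single (a - g) b"]
      by (simp only: poly_ring_def monoid.simps)
    show ?case
      using additive_subgroup.a_closed[OF I.additive_subgroup_axioms aI update.IH[OF \<open>f \<in> J\<close>]] unfolding u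
      by (simp only: poly_ring_def ring.simps)
  qed
  then show ?thesis
    using R.genideal_minimal[OF J GJ] unfolding J_def support_ideal_def by blast
qed

section \<open>Degrees of monomials, and finite dimension of graded chain spaces\<close>

lemma mdeg_eq_sum:
  assumes "Poly_Mapping.keys m \<subseteq> A" "finite A"
  shows "mdeg m = (\<Sum>i\<in>A. Poly_Mapping.lookup m i)"
  unfolding mdeg_def using assms by (intro sum.mono_neutral_left) (auto simp: in_keys_iff)

lemma mdeg_add: "mdeg (a + b) = mdeg a + mdeg b"
proof -
  have "mdeg c = (\<Sum>i\<in>Poly_Mapping.keys a \<union> Poly_Mapping.keys b. Poly_Mapping.lookup c i)"
    if "c \<in> {a, b, a + b}" for c
    using that by (intro mdeg_eq_sum) (auto simp: keys_monomial_add)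
  then show ?thesis by (simp add: lookup_add sum.distrib)
qed

lemma mdeg_single: "mdeg (Poly_Mapping.single t c) = c"
  by (simp add: mdeg_def)

text \<open>A basis of \<open>S\<close> enlarged by \<open>x\<close> is independent and extends to a
  basis of \<open>T\<close>. The finite spanning set makes these bases finite, so strict inclusion
  gives a strict inequality of cardinalities.\<close>

lemma (in vector_space) dim_less:
  assumes "S \<subseteq> T" "x \<in> T" "x \<notin> span S" "finite F" "T \<subseteq> span F"
  shows "dim S < dim T"
proof -
  obtain B where B: "B \<subseteq> S" "independent B" "S \<subseteq> span B" "card B = dim S"
    by (rule basis_exists)
  have "x \<notin> span B" using B(1) assms(3) span_mono by blast
  then have ins: "independent (insert x B)" "x \<notin> B"
    using B(2) independent_insertI span_base by auto
  obtain C where C: "insert x B \<subseteq> C" "C \<subseteq> T" "independent C" "T \<subseteq> span C"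
    using maximal_independent_subset_extend[OF _ ins(1), of T] B(1) assms(1,2) by blast
  have "finite C" using independent_span_bound[OF assms(4) C(3)] C(2) assms(5) by blast
  then have "card B < card C" using C(1) ins(2) by (intro psubset_card_mono) auto
  moreover have "dim T = card C" using C by (intro dim_unique) auto
  ultimately show ?thesis using B(4) by simp
qed

lemma lookup_le_mdeg: "Poly_Mapping.lookup m i \<le> mdeg m"
proof (cases "i \<in> Poly_Mapping.keys m")
  case True
  then show ?thesis unfolding mdeg_def by (intro member_le_sum) auto
qed (simp add: in_keys_iff)

lemma finite_monomials_bounded: "finite {m \<in> monomials n. mdeg m \<le> d}"
proof -
  let ?F = "{f. \<forall>x. (x \<in> {1..n} \<longrightarrow> f x \<in> {..d}) \<and> (x \<notin> {1..n} \<longrightarrow> f x = (0::nat))}"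
  have "finite (Poly_Mapping.lookup -` ?F)"
    by (intro finite_vimageI finite_set_of_finite_funs) (auto simp: inj_def)
  moreover have "{m \<in> monomials n. mdeg m \<le> d} \<subseteq> Poly_Mapping.lookup -` ?F"
  proof
    fix m assume m: "m \<in> {m \<in> monomials n. mdeg m \<le> d}"
    have "Poly_Mapping.lookup m x \<le> d" for x using lookup_le_mdeg[of m x] m by simp
    moreover have "Poly_Mapping.lookup m x = 0" if "x \<notin> {1..n}" for x
      using m that by (auto simp: monomials_def simp flip: not_in_keys_iff_lookup_eq_zero)
    ultimately show "m \<in> Poly_Mapping.lookup -` ?F" by simp
  qed
  ultimately show ?thesis by (rule rev_finite_subset)
qed

lemma sum_fun_apply: "sum f A x = (\<Sum>i\<in>A. f i x)"
  by (induction A rule: infinite_finite_induct) simp_all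

text \<open>The finitely many x^m e_\<sigma>, with \<open>m\<close> a monomial in \<open>n\<close>
  variables of degree at most \<open>d\<close>, span these chains. This supplies the finiteness
  required by \<open>dim_less\<close>.\<close>

lemma finite_span_chains:
  assumes "I \<subseteq> carrier (poly_ring n :: 'k::field mpoly ring)"
  obtains F where "finite F" "tensor_chains_deg (koszul n) I i d \<subseteq> chain_space.span F"
proof -
  let ?M = "{m \<in> monomials n. mdeg m \<le> d}" and ?B = "basis (koszul n :: (nat set, 'k) graded_complex) i"
  let ?e = "\<lambda>\<sigma> m \<rho>. if \<rho> = \<sigma> then monom_poly m else (0 :: 'k mpoly)"
  define F where "F = (\<lambda>(\<sigma>, m). ?e \<sigma> m) ` (?B \<times> ?M)"
  have fin: "finite ?M" "finite ?B" by (rule finite_monomials_bounded) (simp add: koszul_def)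
  have "v \<in> chain_space.span F" if v: "v \<in> tensor_chains_deg (koszul n) I i d" for v
  proof -
    have keys: "Poly_Mapping.keys (v \<sigma>) \<subseteq> ?M" if "\<sigma> \<in> ?B" for \<sigma>
    proof
      fix m assume "m \<in> Poly_Mapping.keys (v \<sigma>)"
      then show "m \<in> ?M"
        using v that assms unfolding tensor_chains_deg_def tensor_chains_def poly_ring_def by fastforce
    qed
    have v0: "v \<rho> = 0" if "\<rho> \<notin> ?B" for \<rho>
      using v that by (auto simp: tensor_chains_deg_def tensor_chains_def)
    have "v = (\<Sum>\<sigma>\<in>?B. \<Sum>m\<in>?M. chain_scale (Poly_Mapping.lookup (v \<sigma>) m) (?e \<sigma> m))" (is "_ = ?R")
    proof (intro ext poly_mapping_eqI)
      fix \<rho> a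
      have "Poly_Mapping.lookup (?R \<rho>) a = (\<Sum>\<sigma>\<in>?B. \<Sum>m\<in>?M. Poly_Mapping.lookup (chain_scale (Poly_Mapping.lookup (v \<sigma>) m) (?e \<sigma> m) \<rho>) a)"
        by (simp add: sum_fun_apply lookup_sum)
      also have "\<dots> = (\<Sum>\<sigma>\<in>?B. \<Sum>m\<in>?M. if \<rho> = \<sigma> then if a = m then Poly_Mapping.lookup (v \<rho>) a else 0 else 0)"
        by (intro sum.cong refl) (auto simp: chain_scale_def monom_poly_def mult_single lookup_single when_def)
      also have "\<dots> = (if \<rho> \<in> ?B then if a \<in> ?M then Poly_Mapping.lookup (v \<rho>) a else 0 else 0)"
      proof -
        have "(\<Sum>m\<in>?M. if a = m then c else 0) = (if a \<in> ?M then c else 0)" for c :: 'k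
          using fin(1) by (rule sum.delta')
        then have "(\<Sum>m\<in>?M. if \<rho> = \<sigma> then if a = m then c else 0 else 0) =
            (if \<rho> = \<sigma> then if a \<in> ?M then c else 0 else 0)" for \<sigma> and c :: 'k
          by (cases "\<rho> = \<sigma>") simp_all
        then show ?thesis using sum.delta'[OF fin(2)] by (simp only:)
      qed
      also have "\<dots> = Poly_Mapping.lookup (v \<rho>) a"
        using keys[of \<rho>] v0[of \<rho>] by (cases "\<rho> \<in> ?B") (auto simp: in_keys_iff subset_iff)
      finally show "Poly_Mapping.lookup (v \<rho>) a = Poly_Mapping.lookup (?R \<rho>) a" by simp
    qed
    also have "\<dots> \<in> chain_space.span F"
      by (intro chain_space.span_sum chain_space.span_scale chain_space.span_base) (auto simp: F_def)
    finally show ?thesis .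
  qed
  moreover have "finite F" using fin by (simp add: F_def)
  ultimately show ?thesis using that by blast
qed

section \<open>Vanishing in nonsquarefree multidegrees\<close>

text \<open>The contracting homotopy in a nonsquarefree multidegree \<open>\<alpha>\<close>: with \<open>q\<close> the least index such that
  \<open>\<alpha>_q \<ge> 2\<close>, it sends \<open>x^a e_\<sigma>\<close> to \<open>\<plusminus> x^(a - q) e_(\<sigma> \<union> {q})\<close> if \<open>q \<notin> \<sigma>\<close>, and to 0 otherwise. It stays
  in the ideal because \<open>x_q\<close> still divides \<open>x^(a - q)\<close>, so that the support does not change.\<close>

lemma koszul_exact_nonsquarefree:
  fixes n i d :: nat and Q
  defines "K \<equiv> koszul n :: (nat set, 'k::field) graded_complex"
    and "I \<equiv> support_ideal n Q :: 'k mpoly set"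
  assumes d: "n < d" and v: "v \<in> tensor_chains_deg K I (Suc i) d" and cyc: "differential K (Suc i) v = 0"
  shows "v \<in> differential K (Suc (Suc i)) ` tensor_chains_deg K I (Suc (Suc i)) d"
proof -
  note One_nat_def [simp del]
  let ?x = "\<lambda>t. Poly_Mapping.single t 1 :: monomial"
  let ?s = "\<lambda>\<tau> t. (-1) ^ card {s\<in>\<tau>. s < t} :: 'k"
  \<comment> \<open>The multidegree of x^a e_\<sigma>.\<close>
  define mul where "mul \<sigma> a s = Poly_Mapping.lookup a s + (if s \<in> \<sigma> then 1 else 0)"
    for \<sigma> and a :: monomial and s :: nat
  define q where "q \<sigma> a = (LEAST s. 2 \<le> mul \<sigma> a s)" for \<sigma> a
  let ?P = "\<lambda>\<rho> a. \<rho> \<subseteq> {1..n} \<and> card \<rho> = Suc (Suc i) \<and> q \<rho> a \<in> \<rho> \<and> 2 \<le> mul \<rho> a (q \<rho> a)"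
  \<comment> \<open>The coefficient of x^a e_\<rho> in the image of \<open>v\<close>. It can only
    come from x^(a + q) e_(\<rho> - q), which has the same multidegree, so q may be computed from
    \<rho> and \<open>a\<close>.\<close>
  define f where "f \<rho> a = (if ?P \<rho> a then ?s (\<rho> - {q \<rho> a}) (q \<rho> a) *
      Poly_Mapping.lookup (v (\<rho> - {q \<rho> a})) (a + ?x (q \<rho> a)) else 0)" for \<rho> a
  define w where "w \<rho> = Abs_poly_mapping (f \<rho>)" for \<rho>
  \<comment> \<open>Finite support is what makes \<open>Abs_poly_mapping\<close> return
    \<open>f\<close> itself. As q varies with \<open>a\<close>, the union runs over all elements of
    \<rho>.\<close>
  have finf: "finite {a. f \<rho> a \<noteq> 0}" for \<rho>
  proof (cases "finite \<rho>")
    case True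
    show ?thesis
    proof (rule finite_subset)
      show "{a. f \<rho> a \<noteq> 0} \<subseteq> (\<Union>t\<in>\<rho>. (\<lambda>a. a + ?x t) -` Poly_Mapping.keys (v (\<rho> - {t})))"
        by (auto simp: f_def in_keys_iff split: if_splits)
      show "finite \<dots>" using True by (intro finite_UN_I finite_vimageI) (auto intro: injI)
    qed
  next
    case False
    then have "f \<rho> a = 0" for a by (simp add: f_def)
    then show ?thesis by simp
  qed
  have w: "Poly_Mapping.lookup (w \<rho>) a = f \<rho> a" for \<rho> a
    unfolding w_def using finf by simp
  have bas: "basis K j = {\<sigma>. \<sigma> \<subseteq> {1..n} \<and> card \<sigma> = j}" "shift K j \<sigma> = j" for j \<sigma>
    by (simp_all add: K_def koszul_def)
  have v0: "v \<sigma> = 0" if "\<not> (\<sigma> \<subseteq> {1..n} \<and> card \<sigma> = Suc i)" for \<sigma>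
    using v that by (auto simp: tensor_chains_deg_def tensor_chains_def bas)
  have vm: "Poly_Mapping.keys m \<subseteq> {1..n} \<and> Q (Poly_Mapping.keys m) \<and> mdeg m + Suc i = d"
    if "m \<in> Poly_Mapping.keys (v \<sigma>)" for m \<sigma>
  proof -
    have "v \<sigma> \<noteq> 0" using that by auto
    then have \<sigma>: "\<sigma> \<subseteq> {1..n} \<and> card \<sigma> = Suc i" using v0 by blast
    then have "v \<sigma> \<in> I" using v by (auto simp: tensor_chains_deg_def tensor_chains_def bas)
    moreover have "mdeg m + Suc i = d" using v that \<sigma> by (auto simp: tensor_chains_deg_def bas)
    ultimately show ?thesis using that by (auto simp: I_def support_ideal_def)
  qed
  have wm: "Poly_Mapping.keys m \<subseteq> {1..n} \<and> Q (Poly_Mapping.keys m) \<and> mdeg m + Suc (Suc i) = d"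
    if "m \<in> Poly_Mapping.keys (w \<rho>)" for m \<rho>
  proof -
    have "f \<rho> m \<noteq> 0" using that by (simp only: in_keys_iff w not_False_eq_True)
    then have P: "?P \<rho> m" and k: "m + ?x (q \<rho> m) \<in> Poly_Mapping.keys (v (\<rho> - {q \<rho> m}))"
      by (auto simp: f_def in_keys_iff split: if_splits)
    have "q \<rho> m \<in> Poly_Mapping.keys m" using P by (auto simp: mul_def in_keys_iff)
    then have "Poly_Mapping.keys (m + ?x (q \<rho> m)) = Poly_Mapping.keys m"
      by (auto simp: keys_monomial_add)
    then show ?thesis using vm[OF k] by (simp add: mdeg_add mdeg_single)
  qed
  have w0: "w \<rho> = 0" if "\<not> (\<rho> \<subseteq> {1..n} \<and> card \<rho> = Suc (Suc i))" for \<rho>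
    using that by (intro poly_mapping_eqI) (auto simp: w f_def)
  have "w \<in> tensor_chains_deg K I (Suc (Suc i)) d"
    using wm w0 by (auto simp: tensor_chains_deg_def tensor_chains_def bas I_def support_ideal_def)
  moreover have "v = differential K (Suc (Suc i)) w"
  proof (intro ext poly_mapping_eqI)
    fix \<sigma> a
    show "Poly_Mapping.lookup (v \<sigma>) a = Poly_Mapping.lookup (differential K (Suc (Suc i)) w \<sigma>) a"
    proof (cases "\<sigma> \<subseteq> {1..n} \<and> card \<sigma> = Suc i")
      case False
      then show ?thesis by (auto simp: v0 K_def lookup_differential_koszul)
    next
      case True
      then have fin: "finite \<sigma>" using finite_subset by blast
      let ?g = "\<lambda>t. ?s \<sigma> t * (if Poly_Mapping.lookup a t = 0 then 0 else f (insert t \<sigma>) (a - ?x t))"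
      have D: "Poly_Mapping.lookup (differential K (Suc (Suc i)) w \<sigma>) a = (\<Sum>t\<in>{1..n} - \<sigma>. ?g t)"
        using True unfolding K_def lookup_differential_koszul w by simp
      \<comment> \<open>The differential preserves multidegrees, so all terms contributing to x^a
        e_\<sigma> share its q.\<close>
      have mul': "mul (insert t \<sigma>) (a - ?x t) = mul \<sigma> a"
        if "t \<notin> \<sigma>" "Poly_Mapping.lookup a t \<noteq> 0" for t
        using that by (auto simp: mul_def lookup_minus lookup_single when_def)
      then have q': "q (insert t \<sigma>) (a - ?x t) = q \<sigma> a"
        if "t \<notin> \<sigma>" "Poly_Mapping.lookup a t \<noteq> 0" for t using that by (simp add: q_def)
      define r where "r = q \<sigma> a"
      show ?thesis
      proof (cases "2 \<le> mul \<sigma> a r")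
        case False
        then have small: "mul \<sigma> a s \<le> 1" for s
          using LeastI[of "\<lambda>s. 2 \<le> mul \<sigma> a s" s] unfolding r_def q_def by linarith
        \<comment> \<open>If no coordinate of the multidegree reaches 2, its total is at most
          \<open>n\<close>, whereas \<open>v\<close> lives in degree \<open>d > n\<close>.\<close>
        have "a \<notin> Poly_Mapping.keys (v \<sigma>)"
        proof
          assume "a \<in> Poly_Mapping.keys (v \<sigma>)"
          then have "Poly_Mapping.keys a \<subseteq> {1..n}" "mdeg a + Suc i = d" using vm by auto
          then have "d = (\<Sum>s\<in>{1..n}. Poly_Mapping.lookup a s) + (\<Sum>s\<in>{1..n}. if s \<in> \<sigma> then 1 else 0)"
            using True by (simp add: mdeg_eq_sum sum.If_cases Int_absorb1)
          also have "\<dots> = (\<Sum>s\<in>{1..n}. mul \<sigma> a s)" by (simp add: mul_def sum.distrib)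
          also have "\<dots> \<le> (\<Sum>s\<in>{1..n}. 1)" by (intro sum_mono small)
          finally show False using d by simp
        qed
        moreover have "?g t = 0" if "t \<in> {1..n} - \<sigma>" for t
          using that False mul'[of t] q'[of t] by (auto simp: f_def r_def)
        ultimately show ?thesis unfolding D by (simp add: in_keys_iff)
      next
        case r2: True
        show ?thesis
        proof (cases "r \<in> \<sigma>")
          case False
          \<comment> \<open>For \<open>t\<close> other than \<open>r\<close>, the set \<sigma>
            \<union> {t} misses \<open>r\<close>, so \<open>w\<close> contributes nothing. In the
            summand \<open>t = r\<close> the sign occurs twice and cancels.\<close>
          have "?g t = (if t = r then Poly_Mapping.lookup (v \<sigma>) a else 0)" if t: "t \<in> {1..n} - \<sigma>" for t
          proof (cases "Poly_Mapping.lookup a t = 0")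
            case True
            then show ?thesis using r2 False by (auto simp: mul_def)
          next
            case at: False
            note q't = q'[of t] mul'[of t]
            show ?thesis
            proof (cases "t = r")
              case True
              have "?P (insert t \<sigma>) (a - ?x t)"
                using t at q't r2 True \<open>\<sigma> \<subseteq> _ \<and> _\<close> fin by (auto simp: r_def)
              moreover have "insert t \<sigma> - {t} = \<sigma>" using t by auto
              moreover have "a - ?x t + ?x t = a"
                using at by (intro poly_mapping_eqI) (auto simp: lookup_add lookup_minus lookup_single when_def)
              moreover have "q (insert t \<sigma>) (a - ?x t) = t" using q't t at True by (simp add: r_def)
              ultimately have "f (insert t \<sigma>) (a - ?x t) = ?s \<sigma> t * Poly_Mapping.lookup (v \<sigma>) a"
                by (simp add: f_def)
              then show ?thesis using at True by (simp flip: power_add mult.assoc)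
            next
              case False
              then have "q (insert t \<sigma>) (a - ?x t) \<notin> insert t \<sigma>"
                using q't t at \<open>r \<notin> \<sigma>\<close> by (simp add: r_def)
              then have "f (insert t \<sigma>) (a - ?x t) = 0" by (simp add: f_def)
              then show ?thesis using False by simp
            qed
          qed
          then have "(\<Sum>t\<in>{1..n} - \<sigma>. ?g t) = (\<Sum>t\<in>{1..n} - \<sigma>. if t = r then Poly_Mapping.lookup (v \<sigma>) a else 0)"
            by (intro sum.cong refl)
          also have "\<dots> = Poly_Mapping.lookup (v \<sigma>) a"
          proof (cases "r \<in> {1..n}")
            case True
            then show ?thesis using False by simp
          next
            \<comment> \<open>The least index is sought among all naturals, so \<open>r\<close>
              could lie outside \<open>{1..n}\<close>; then x_r divides x^a, and \<open>v\<close>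
              has no such term.\<close>
            case r: False
            have "r \<in> Poly_Mapping.keys a" using r2 False by (auto simp: mul_def in_keys_iff)
            then have "a \<notin> Poly_Mapping.keys (v \<sigma>)" using vm[of a \<sigma>] r by blast
            then show ?thesis by (simp add: in_keys_iff)
          qed
          finally show ?thesis unfolding D by simp
        next
          case r\<sigma>: True
          \<comment> \<open>Moving \<open>r\<close> from \<sigma> to the monomial yields a
            coefficient of the boundary of \<open>v\<close>, which is zero. Its summand
            \<open>t = r\<close> is, up to sign, the coefficient of x^a e_\<sigma> in
            \<open>v\<close>; the others are the \<open>?g t\<close> up to a common sign.\<close>
          define \<tau> where "\<tau> = \<sigma> - {r}"
          have \<tau>: "\<sigma> = insert r \<tau>" "r \<notin> \<tau>" "\<tau> \<subseteq> {1..n}" "card \<tau> = i" "finite \<tau>" "r \<in> {1..n}"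
            using True r\<sigma> fin by (auto simp: \<tau>_def)
          let ?h = "\<lambda>t. ?s \<tau> t * (if Poly_Mapping.lookup (a + ?x r) t = 0 then 0
             else Poly_Mapping.lookup (v (insert t \<tau>)) (a + ?x r - ?x t))"
          have gh: "?g t = - (?s \<tau> r * ?h t)" if t: "t \<in> {1..n} - \<sigma>" for t
          proof (cases "Poly_Mapping.lookup a t = 0")
            case True
            then show ?thesis using t r\<sigma> by (auto simp: lookup_add lookup_single when_def)
          next
            case at: False
            have tr: "t \<noteq> r" "t \<notin> \<tau>" using t \<tau>(1) by auto
            have qr: "q (insert t \<sigma>) (a - ?x t) = r" "mul (insert t \<sigma>) (a - ?x t) = mul \<sigma> a"
              using q'[of t] mul'[of t] t at by (simp_all add: r_def)
            have "?P (insert t \<sigma>) (a - ?x t)"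
              unfolding qr using t r2 True fin r\<sigma> by auto
            moreover have "insert t \<sigma> - {r} = insert t \<tau>" using \<tau> tr by auto
            moreover have "a - ?x t + ?x r = a + ?x r - ?x t"
              using at tr by (intro poly_mapping_eqI)
                (auto simp: lookup_add lookup_minus lookup_single when_def)
            ultimately have f: "f (insert t \<sigma>) (a - ?x t) =
                ?s (insert t \<tau>) r * Poly_Mapping.lookup (v (insert t \<tau>)) (a + ?x r - ?x t)"
              by (simp add: f_def qr)
            have sq: "?s \<tau> r * ?s \<tau> r = 1" "?s (insert t \<tau>) r * ?s (insert t \<tau>) r = 1"
              by (simp_all flip: power_add)
            have sw: "?s \<tau> r * ?s \<sigma> t = - (?s \<tau> t * ?s (insert t \<tau>) r)"
              unfolding \<tau>(1) using sign_swap[of \<tau> r t] \<tau> tr by auto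
            have "?s \<sigma> t * ?s (insert t \<tau>) r = ?s \<tau> r * (?s \<tau> r * ?s \<sigma> t) * ?s (insert t \<tau>) r"
              using sq(1) by (simp flip: mult.assoc)
            also have "\<dots> = - (?s \<tau> r * ?s \<tau> t * (?s (insert t \<tau>) r * ?s (insert t \<tau>) r))"
              unfolding sw by simp
            finally have "?s \<sigma> t * ?s (insert t \<tau>) r = - (?s \<tau> r * ?s \<tau> t)" unfolding sq by simp
            then show ?thesis using at tr by (simp add: f lookup_add lookup_single flip: mult.assoc)
          qed
          have "0 = Poly_Mapping.lookup (differential K (Suc i) v \<tau>) (a + ?x r)"
            using cyc by simp
          also have "\<dots> = (\<Sum>t\<in>{1..n} - \<tau>. ?h t)"
            using \<tau> by (simp add: K_def lookup_differential_koszul)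
          also have "{1..n} - \<tau> = insert r ({1..n} - \<sigma>)" using \<tau> by auto
          also have "(\<Sum>t\<in>insert r ({1..n} - \<sigma>). ?h t) = ?h r + (\<Sum>t\<in>{1..n} - \<sigma>. ?h t)"
            using r\<sigma> by simp
          also have "?h r = ?s \<tau> r * Poly_Mapping.lookup (v \<sigma>) a"
            unfolding \<tau>(1) by (simp add: lookup_add)
          finally have c: "(\<Sum>t\<in>{1..n} - \<sigma>. ?h t) = - (?s \<tau> r * Poly_Mapping.lookup (v \<sigma>) a)"
            by (simp add: add_eq_0_iff eq_commute[of 0])
          have "(\<Sum>t\<in>{1..n} - \<sigma>. ?g t) = - (?s \<tau> r * (\<Sum>t\<in>{1..n} - \<sigma>. ?h t))"
            unfolding sum_distrib_left sum_negf[symmetric] by (intro sum.cong refl gh)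
          also have "\<dots> = Poly_Mapping.lookup (v \<sigma>) a"
            unfolding c by (simp flip: power_add mult.assoc)
          finally show ?thesis unfolding D by simp
        qed
      qed
    qed
  qed
  ultimately show ?thesis by blast
qed

text \<open>Lets support and degree of a boundary be checked on single monomials, without regard to
  signs or cancellation.\<close>

lemma keys_differential_koszul:
  fixes v :: "nat set \<Rightarrow> 'k::field mpoly"
  assumes m: "m \<in> Poly_Mapping.keys (differential (koszul n) (Suc i) v \<tau>)"
  obtains t m' where "\<tau> \<subseteq> {1..n}" "card \<tau> = i" "t \<in> {1..n} - \<tau>"
    "m' \<in> Poly_Mapping.keys (v (insert t \<tau>))" "m = m' + Poly_Mapping.single t 1"
proof -
  note One_nat_def [simp del]
  have nz: "Poly_Mapping.lookup (differential (koszul n) (Suc i) v \<tau>) m \<noteq> 0" using m by (simp add: in_keys_iff)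
  then have \<tau>: "\<tau> \<subseteq> {1..n}" "card \<tau> = i" by (auto simp: lookup_differential_koszul split: if_splits)
  obtain t where t: "t \<in> {1..n} - \<tau>" "Poly_Mapping.lookup m t \<noteq> 0"
      "Poly_Mapping.lookup (v (insert t \<tau>)) (m - Poly_Mapping.single t 1) \<noteq> 0"
    using nz \<tau> unfolding lookup_differential_koszul
    by (auto elim!: sum.not_neutral_contains_not_neutral split: if_splits)
  have "m = (m - Poly_Mapping.single t 1) + Poly_Mapping.single t 1"
    using t(2) by (intro poly_mapping_eqI) (auto simp: lookup_add lookup_minus lookup_single when_def)
  then show ?thesis using that \<tau> t by (simp add: in_keys_iff)
qed

text \<open>The factor x_t raises the degree of a monomial by one, making up for the shift that
  falls by one, and it only enlarges the support, so \<open>Q\<close> persists.\<close>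

lemma differential_koszul_chains_deg:
  assumes Q: "\<And>A B. Q A \<Longrightarrow> A \<subseteq> B \<Longrightarrow> B \<subseteq> {1..n} \<Longrightarrow> Q B"
    and v: "v \<in> tensor_chains_deg (koszul n) (support_ideal n Q :: 'k::field mpoly set) (Suc i) d"
  shows "differential (koszul n) (Suc i) v \<in> tensor_chains_deg (koszul n) (support_ideal n Q) i d"
proof -
  let ?K = "koszul n :: (nat set, 'k) graded_complex"
  have bas: "basis ?K j = {\<sigma>. \<sigma> \<subseteq> {1..n} \<and> card \<sigma> = j}" "shift ?K j \<sigma> = j" for j \<sigma>
    by (simp_all add: koszul_def)
  have "Poly_Mapping.keys m \<subseteq> {1..n} \<and> Q (Poly_Mapping.keys m) \<and> mdeg m + i = d"
    if m: "m \<in> Poly_Mapping.keys (differential ?K (Suc i) v \<tau>)" for m \<tau>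
  proof -
    obtain t m' where \<tau>: "\<tau> \<subseteq> {1..n}" "card \<tau> = i" and t: "t \<in> {1..n} - \<tau>"
      and m': "m' \<in> Poly_Mapping.keys (v (insert t \<tau>))" and mm: "m = m' + Poly_Mapping.single t 1"
      using m by (rule keys_differential_koszul)
    have "insert t \<tau> \<in> basis ?K (Suc i)" using \<tau> t finite_subset[OF \<tau>(1)] by (auto simp: bas)
    then have vI: "v (insert t \<tau>) \<in> support_ideal n Q"
      and "mdeg m' + shift ?K (Suc i) (insert t \<tau>) = d"
      using v m' unfolding tensor_chains_deg_def tensor_chains_def by blast+
    then have deg: "mdeg m' + Suc i = d" by (simp add: bas)
    have "Poly_Mapping.keys m' \<subseteq> {1..n}" "Q (Poly_Mapping.keys m')"
      using m' vI by (simp_all add: support_ideal_def)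
    moreover have "Poly_Mapping.keys m = insert t (Poly_Mapping.keys m')"
      unfolding mm keys_monomial_add by simp
    ultimately show ?thesis
      using t Q[of "Poly_Mapping.keys m'" "Poly_Mapping.keys m"] deg by (auto simp: mm mdeg_add mdeg_single)
  qed
  moreover have "differential ?K (Suc i) v \<tau> = 0" if "\<tau> \<notin> basis ?K i" for \<tau>
    using that by (auto simp: bas differential_koszul)
  ultimately show ?thesis
    by (auto simp: tensor_chains_deg_def tensor_chains_def support_ideal_def bas)
qed

text \<open>By the contracting homotopy, cycles and boundaries coincide as sets, so the two
  dimensions subtracted are equal.\<close>

lemma graded_betti_eq_0:
  assumes Q: "\<And>A B. Q A \<Longrightarrow> A \<subseteq> B \<Longrightarrow> B \<subseteq> {1..n} \<Longrightarrow> Q B" and d: "n < d"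
  shows "graded_betti n (support_ideal n Q :: 'k::field mpoly set) (Suc i) d = 0"
proof -
  let ?I = "support_ideal n Q :: 'k mpoly set"
  have "{v \<in> tensor_chains_deg (koszul n) ?I (Suc i) d. differential (koszul n) (Suc i) v = 0} =
      differential (koszul n) (Suc (Suc i)) ` tensor_chains_deg (koszul n) ?I (Suc (Suc i)) d"
    using koszul_exact_nonsquarefree[OF d] differential_koszul_chains_deg[of Q n, OF Q]
    by (auto simp: differential_koszul_differential_koszul)
  then show ?thesis by (simp add: graded_betti_def tensor_homology_dim_def)
qed

section \<open>Nonvanishing in degree \<open>n\<close>\<close>

definition set_monom :: "nat set \<Rightarrow> monomial" where
  "set_monom A = (\<Sum>i\<in>A. Poly_Mapping.single i 1)"

lemma lookup_set_monom: "finite A \<Longrightarrow> Poly_Mapping.lookup (set_monom A) i = (if i \<in> A then 1 else 0)"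
  by (simp add: set_monom_def lookup_sum lookup_single when_def)

lemma keys_set_monom: "finite A \<Longrightarrow> Poly_Mapping.keys (set_monom A) = A"
  by (auto simp: in_keys_iff lookup_set_monom split: if_splits)

lemma mdeg_set_monom: "finite A \<Longrightarrow> mdeg (set_monom A) = card A"
  by (simp add: mdeg_def keys_set_monom lookup_set_monom)

lemma lookup_const_mult:
  "Poly_Mapping.lookup (Poly_Mapping.single 0 c * p) m = c * Poly_Mapping.lookup (p :: 'k::field mpoly) m"
  by (simp add: lookup_mult lookup_single when_mult)

text \<open>The class is that of the boundary, taken in the Koszul complex of the whole ring, of
  \<open>x^(u - n) e_(\<sigma> \<union> {n})\<close>, where \<open>\<sigma>\<close> is the complement of \<open>u\<close>. Its coefficient of \<open>x^u e_\<sigma>\<close> is a sign, whereas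
  this coefficient vanishes in boundaries of chains over the ideal, as \<open>u\<close> is a minimal generator.\<close>

lemma graded_betti_top_nonzero:
  fixes u :: "nat set"
  assumes u: "u \<subseteq> {1..n}" "n \<in> u" "card u < n"
    and Q: "\<And>A B. Q A \<Longrightarrow> A \<subseteq> B \<Longrightarrow> B \<subseteq> {1..n} \<Longrightarrow> Q B"
    and Qins: "\<And>t. t \<in> {1..n} \<Longrightarrow> t \<notin> u - {n} \<Longrightarrow> Q (insert t (u - {n}))"
    and Qdel: "\<And>t. t \<in> u \<Longrightarrow> \<not> Q (u - {t})"
  shows "graded_betti n (support_ideal n Q :: 'k::field mpoly set) (n - card u) n \<noteq> 0"
proof -
  note One_nat_def [simp del]
  let ?x = "\<lambda>t. Poly_Mapping.single t 1 :: monomial"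
  let ?I = "support_ideal n Q :: 'k mpoly set" and ?K = "koszul n :: (nat set, 'k) graded_complex"
  define k where "k = n - card u"
  obtain j where j: "k = Suc j" using u(3) by (cases k) (auto simp: k_def)
  have finu: "finite u" using u(1) finite_subset by blast
  define \<sigma> where "\<sigma> = {1..n} - u"
  have \<sigma>: "\<sigma> \<subseteq> {1..n}" "card \<sigma> = k" "{1..n} - \<sigma> = u"
    using u(1) finu by (auto simp: \<sigma>_def k_def card_Diff_subset)
  define b where "b = set_monom (u - {n})"
  have b: "Poly_Mapping.keys b = u - {n}" "mdeg b + 1 = card u"
    using finu u(2) card_Suc_Diff1[OF finu u(2)] by (simp_all add: b_def keys_set_monom mdeg_set_monom)
  define y where "y = (\<lambda>\<rho>. if \<rho> = insert n \<sigma> then monom_poly b else (0 :: 'k mpoly))"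
  define z where "z = differential ?K (Suc k) y"
  have bas: "basis ?K j = {\<sigma>. \<sigma> \<subseteq> {1..n} \<and> card \<sigma> = j}" "shift ?K j \<sigma> = j" for j \<sigma>
    by (simp_all add: koszul_def)
  have z0: "z \<tau> = 0" if "\<not> (\<tau> \<subseteq> {1..n} \<and> card \<tau> = k)" for \<tau>
    using that by (auto simp: z_def differential_koszul)
  have zm: "Poly_Mapping.keys m \<subseteq> {1..n} \<and> Q (Poly_Mapping.keys m) \<and> mdeg m + k = n"
    if m: "m \<in> Poly_Mapping.keys (z \<tau>)" for m \<tau>
  proof -
    obtain t m' where \<tau>: "\<tau> \<subseteq> {1..n}" "card \<tau> = k" and t: "t \<in> {1..n} - \<tau>"
      and m': "m' \<in> Poly_Mapping.keys (y (insert t \<tau>))" and mm: "m = m' + ?x t"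
      using m unfolding z_def by (rule keys_differential_koszul)
    \<comment> \<open>\<open>y\<close> is supported on \<sigma> \<union> {n} alone, which forces
      \<open>t\<close> into this set and hence outside \<open>u - {n}\<close>.\<close>
    have t': "insert t \<tau> = insert n \<sigma>" and mb: "m = b + ?x t"
      using m' by (auto simp: y_def monom_poly_def mm split: if_splits)
    have "t \<in> insert n \<sigma>" using t' by blast
    then have tu: "t \<notin> u - {n}" by (auto simp: \<sigma>_def)
    have "Poly_Mapping.keys m = insert t (u - {n})" unfolding mb keys_monomial_add b(1) by auto
    moreover have "mdeg m + k = n" using b(2) u(3) by (simp add: mb mdeg_add mdeg_single k_def)
    ultimately show ?thesis using t u(1) Qins[of t] tu by auto
  qed
  have zc: "z \<in> tensor_chains_deg ?K ?I k n"
    using zm z0 by (auto simp: tensor_chains_deg_def tensor_chains_def bas support_ideal_def)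
  have zcyc: "differential ?K k z = 0"
    unfolding z_def j by (rule differential_koszul_differential_koszul)
  let ?L = "\<lambda>v. Poly_Mapping.lookup (v \<sigma>) (set_monom u) :: 'k"
  have L: "?L (differential ?K (Suc k) v) = (\<Sum>t\<in>u. (-1) ^ card {s\<in>\<sigma>. s < t} *
      Poly_Mapping.lookup (v (insert t \<sigma>)) (set_monom (u - {t})))" for v
  proof -
    have "set_monom u - ?x t = set_monom (u - {t})" if "t \<in> u" for t
      using that finu by (intro poly_mapping_eqI) (auto simp: lookup_minus lookup_set_monom lookup_single when_def)
    then show ?thesis using \<sigma> finu by (simp add: lookup_differential_koszul lookup_set_monom)
  qed
  have "?L z = (\<Sum>t\<in>u. if t = n then (-1) ^ card {s\<in>\<sigma>. s < n} else 0)"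
    unfolding z_def L
  proof (intro sum.cong refl)
    fix t assume t: "t \<in> u"
    have "insert t \<sigma> = insert n \<sigma> \<longleftrightarrow> t = n" using t u(2) by (auto simp: \<sigma>_def)
    then show "(-1) ^ card {s\<in>\<sigma>. s < t} * Poly_Mapping.lookup (y (insert t \<sigma>)) (set_monom (u - {t})) =
        (if t = n then (-1) ^ card {s\<in>\<sigma>. s < n} else 0 :: 'k)"
      by (auto simp: y_def b_def monom_poly_def)
  qed
  then have Lz: "?L z \<noteq> 0" using u(2) finu by simp
  have sub: "chain_space.subspace {v. ?L v = 0}"
    by (rule chain_space.subspaceI) (auto simp: lookup_add chain_scale_def lookup_const_mult)
  have LB: "?L w = 0" if w: "w \<in> differential ?K (Suc k) ` tensor_chains_deg ?K ?I (Suc k) n" for w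
  proof -
    obtain v where v: "w = differential ?K (Suc k) v" "v \<in> tensor_chains_deg ?K ?I (Suc k) n"
      using w by blast
    have "Poly_Mapping.lookup (v (insert t \<sigma>)) (set_monom (u - {t})) = 0" if t: "t \<in> u" for t
    proof -
      have "t \<notin> \<sigma>" "finite \<sigma>" using t by (auto simp: \<sigma>_def)
      then have "insert t \<sigma> \<in> basis ?K (Suc k)" using t u(1) \<sigma> by (auto simp: bas)
      then have "v (insert t \<sigma>) \<in> ?I" using v(2) by (simp add: tensor_chains_deg_def tensor_chains_def)
      then have "set_monom (u - {t}) \<notin> Poly_Mapping.keys (v (insert t \<sigma>))"
        using Qdel[OF t] finu by (auto simp: support_ideal_def keys_set_monom)
      then show ?thesis by (simp add: in_keys_iff)
    qed
    then show ?thesis unfolding v(1) L by simp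
  qed
  let ?Z = "{v \<in> tensor_chains_deg ?K ?I k n. differential ?K k v = 0}"
  let ?B = "differential ?K (Suc k) ` tensor_chains_deg ?K ?I (Suc k) n"
  obtain F where F: "finite F" "tensor_chains_deg ?K ?I k n \<subseteq> chain_space.span F"
    using finite_span_chains[OF support_ideal_subset_carrier] by blast
  \<comment> \<open>\<open>tensor_homology_dim\<close> is a truncated difference, so a strict
    inequality is required; \<open>z\<close> is a cycle that the functional \<open>?L\<close>
    separates from the boundaries.\<close>
  have "chain_space.dim ?B < chain_space.dim ?Z"
  proof (rule chain_space.dim_less)
    show "?B \<subseteq> ?Z"
      using differential_koszul_chains_deg[of Q n, OF Q] differential_koszul_differential_koszul
      unfolding j by auto
    show "z \<in> ?Z" using zc zcyc by simp
    have "chain_space.span ?B \<subseteq> {v. ?L v = 0}" using LB sub by (intro chain_space.span_minimal) auto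
    then show "z \<notin> chain_space.span ?B" using Lz by blast
  qed (use F in auto)
  then show ?thesis by (simp add: graded_betti_def tensor_homology_dim_def k_def)
qed

section \<open>Decreasing sequences of binary words\<close>

lemma set_encode_less_power:
  assumes "A \<subseteq> {..<N}"
  shows "set_encode A < 2 ^ N"
proof -
  have "set_encode A \<le> (\<Sum>i<N. 2 ^ i)" unfolding set_encode_def using assms by (intro sum_mono2) auto
  also have "\<dots> < 2 ^ N" by (simp add: lessThan_atLeast0 sum_power2)
  finally show ?thesis .
qed

text \<open>In binary notation, the words of length \<open>M\<close> with \<open>2, \<dots>, M - 2\<close> ones are
  \<open>10\<dots>01\<close>, then \<open>01\<close> followed by the words obtained for \<open>M - 2\<close>, and finally \<open>001\<dots>1\<close>.\<close>

lemma decreasing_codes_inner: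
  "\<exists>f. (\<forall>c\<in>{2..M - 2}. f c \<subseteq> {..<M} \<and> 0 \<in> f c \<and> card (f c) = c) \<and>
       (\<forall>c\<in>{2..<M - 2}. set_encode (f (Suc c)) \<le> set_encode (f c))"
proof (induction M rule: less_induct)
  case (less M)
  show ?case
  proof (cases "M < 4")
    case True
    then have "{2..M - 2} = {}" "{2..<M - 2} = {}" by auto
    then show ?thesis by simp
  next
    case False
    define N where "N = M - 2"
    have N: "M = N + 2" "N \<ge> 2" using False by (simp_all add: N_def)
    obtain g :: "nat \<Rightarrow> nat set" where g_all: "\<forall>c\<in>{2..N - 2}. g c \<subseteq> {..<N} \<and> 0 \<in> g c \<and> card (g c) = c"
      "\<forall>c\<in>{2..<N - 2}. set_encode (g (Suc c)) \<le> set_encode (g c)"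
      using less[of N] N(1) by auto
    note g = bspec[OF g_all(1)] and gd = bspec[OF g_all(2)]
    \<comment> \<open>The two leading digits are the bits \<open>Suc N\<close> and \<open>N\<close>.
      The prefix 01 accounts for one of the \<open>c\<close> ones, hence \<open>g (c - 1)\<close>.
      For \<open>N = 2\<close> only the first clause occurs.\<close>
    define f where "f c = (if c = 2 then {0, Suc N} else if c = N then {..<N} else insert N (g (c - 1)))" for c
    have gf: "g (c - 1) \<subseteq> {..<N}" "0 \<in> g (c - 1)" "card (g (c - 1)) = c - 1" "finite (g (c - 1))"
        "N \<notin> g (c - 1)" if "2 < c" "c < N" for c
    proof -
      have "c - 1 \<in> {2..N - 2}" using that by auto
      then show "g (c - 1) \<subseteq> {..<N}" "0 \<in> g (c - 1)" "card (g (c - 1)) = c - 1"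
        using g by blast+
      then show "finite (g (c - 1))" "N \<notin> g (c - 1)" by (auto dest: finite_subset)
    qed
    have "f c \<subseteq> {..<M} \<and> 0 \<in> f c \<and> card (f c) = c" if c: "c \<in> {2..N}" for c
      using gf[of c] c N by (auto simp: f_def less_Suc_eq dest: subsetD)
    moreover have "set_encode (f (Suc c)) \<le> set_encode (f c)" if c: "c \<in> {2..<N}" for c
    proof (cases "c = 2")
      case True
      have "g c \<subseteq> {..<N}" if "Suc c \<noteq> N" using gf(1)[of "Suc c"] c True that by simp
      then have "f (Suc c) \<subseteq> {..<Suc N}" using True by (auto simp: f_def less_Suc_eq dest: subsetD)
      then have "set_encode (f (Suc c)) < 2 ^ Suc N" by (rule set_encode_less_power)
      also have "\<dots> \<le> set_encode (f c)" using True by (simp add: f_def)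
      finally show ?thesis by simp
    next
      case c2: False
      then have fc: "f c = insert N (g (c - 1))" "set_encode (f c) = 2 ^ N + set_encode (g (c - 1))"
        using c gf[of c] by (auto simp: f_def)
      show ?thesis
      proof (cases "Suc c = N")
        case True
        then have "set_encode (f (Suc c)) < 2 ^ N" using c2 c by (intro set_encode_less_power) (auto simp: f_def)
        then show ?thesis using fc by simp
      next
        case False
        then have "set_encode (f (Suc c)) = 2 ^ N + set_encode (g (Suc (c - 1)))"
          using c c2 gf[of "Suc c"] by (auto simp: f_def)
        moreover have "c - 1 \<in> {2..<N - 2}" using c c2 False by auto
        ultimately show ?thesis using gd[of "c - 1"] fc by simp
      qed
    qed
    ultimately show ?thesis using N by (intro exI[of _ f]) simp
  qed
qed

text \<open>For \<open>c < n - 1\<close> a leading 1 is put before an inner word of length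
  \<open>n - 1\<close> with \<open>c - 1\<close> ones; \<open>c = n - 1\<close> gets 01...1. Inner
  words have at least two ones, so \<open>c\<close> starts at 3.\<close>

lemma decreasing_codes:
  obtains f where "\<And>c. c \<in> {3..<n} \<Longrightarrow> f c \<subseteq> {..<n} \<and> 0 \<in> f c \<and> card (f c) = c"
    and "\<And>c. c \<in> {3..<n - 1} \<Longrightarrow> set_encode (f (Suc c)) \<le> set_encode (f c)"
proof -
  define N where "N = n - 1"
  obtain g :: "nat \<Rightarrow> nat set" where g_all: "\<forall>c\<in>{2..N - 2}. g c \<subseteq> {..<N} \<and> 0 \<in> g c \<and> card (g c) = c"
    "\<forall>c\<in>{2..<N - 2}. set_encode (g (Suc c)) \<le> set_encode (g c)"
    using decreasing_codes_inner[of N] by blast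
  note g = bspec[OF g_all(1)] and gd = bspec[OF g_all(2)]
  define f where "f c = (if c = N then {..<N} else insert N (g (c - 1)))" for c
  have gf: "g (c - 1) \<subseteq> {..<N}" "0 \<in> g (c - 1)" "card (g (c - 1)) = c - 1" "finite (g (c - 1))"
      "N \<notin> g (c - 1)" if "2 < c" "c < N" for c
  proof -
    have "c - 1 \<in> {2..N - 2}" using that by auto
    then show "g (c - 1) \<subseteq> {..<N}" "0 \<in> g (c - 1)" "card (g (c - 1)) = c - 1"
      using g by blast+
    then show "finite (g (c - 1))" "N \<notin> g (c - 1)" by (auto dest: finite_subset)
  qed
  have "f c \<subseteq> {..<n} \<and> 0 \<in> f c \<and> card (f c) = c" if c: "c \<in> {3..<n}" for c
  proof -
    have "n = Suc N" using c by (auto simp: N_def)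
    then show ?thesis using gf[of c] c by (auto simp: f_def less_Suc_eq dest: subsetD)
  qed
  moreover have "set_encode (f (Suc c)) \<le> set_encode (f c)" if c: "c \<in> {3..<n - 1}" for c
  proof -
    have fc: "set_encode (f c) = 2 ^ N + set_encode (g (c - 1))"
      using c gf[of c] by (auto simp: f_def N_def)
    show ?thesis
    proof (cases "Suc c = N")
      case True
      then have "set_encode (f (Suc c)) < 2 ^ N" by (intro set_encode_less_power) (auto simp: f_def)
      then show ?thesis using fc by simp
    next
      case False
      then have "set_encode (f (Suc c)) = 2 ^ N + set_encode (g (Suc (c - 1)))"
        using c gf[of "Suc c"] by (auto simp: f_def N_def)
      moreover have "c - 1 \<in> {2..<N - 2}" using c False by (auto simp: N_def)
      ultimately show ?thesis using gd[of "c - 1"] fc by simp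
    qed
  qed
  ultimately show ?thesis using that by blast
qed

text \<open>The squarefree lex order compares the numbers whose leading binary digit corresponds to \<open>x_1\<close>.\<close>

definition lex_value :: "nat \<Rightarrow> nat set \<Rightarrow> nat" where
  "lex_value n A = (\<Sum>i\<in>A. 2 ^ (n - i))"

lemma lex_value_mono: "A \<subseteq> B \<Longrightarrow> finite B \<Longrightarrow> lex_value n A \<le> lex_value n B"
  unfolding lex_value_def by (intro sum_mono2) auto

text \<open>Bit j stands for x_(n - j). In particular bit 0 becomes x_n, so a word ending in 1 gives
  a monomial divisible by x_n.\<close>

lemma lex_value_reflect:
  assumes "B \<subseteq> {..<n}"
  shows "lex_value n ((\<lambda>i. n - i) ` B) = set_encode B"
proof -
  have "inj_on (\<lambda>i. n - i) B" using assms by (intro inj_onI) (metis diff_diff_cancel lessThan_iff less_imp_le subsetD)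
  then have "lex_value n ((\<lambda>i. n - i) ` B) = (\<Sum>i\<in>B. 2 ^ (n - (n - i)))"
    unfolding lex_value_def by (simp add: sum.reindex)
  also have "\<dots> = set_encode B" unfolding set_encode_def using assms
    by (intro sum.cong refl) (auto simp: diff_diff_cancel subset_iff less_imp_le)
  finally show ?thesis .
qed

text \<open>The binary words, read as supports. Weak decrease is enough for minimality of the
  generators, since deleting a variable lowers the value strictly.\<close>

lemma decreasing_lex_values:
  obtains u where "\<And>c. c \<in> {3..<n} \<Longrightarrow> u c \<subseteq> {1..n} \<and> n \<in> u c \<and> card (u c) = c"
    and "\<And>c c'. 3 \<le> c \<Longrightarrow> c \<le> c' \<Longrightarrow> c' < n \<Longrightarrow> lex_value n (u c') \<le> lex_value n (u c)"
proof -
  obtain f where f: "\<And>c. c \<in> {3..<n} \<Longrightarrow> f c \<subseteq> {..<n} \<and> 0 \<in> f c \<and> card (f c) = c"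
    and fd: "\<And>c. c \<in> {3..<n - 1} \<Longrightarrow> set_encode (f (Suc c)) \<le> set_encode (f c)"
    by (rule decreasing_codes) blast
  define u where "u c = (\<lambda>i. n - i) ` f c" for c
  have "u c \<subseteq> {1..n} \<and> n \<in> u c \<and> card (u c) = c" if c: "c \<in> {3..<n}" for c
  proof -
    have "inj_on (\<lambda>i. n - i) (f c)"
      using f[OF c] by (intro inj_onI) (metis diff_diff_cancel lessThan_iff less_imp_le subsetD)
    moreover have "n \<in> u c" unfolding u_def using f[OF c] by (intro image_eqI[of _ _ 0]) auto
    ultimately show ?thesis using f[OF c] by (auto simp: u_def card_image)
  qed
  moreover have "lex_value n (u c') \<le> lex_value n (u c)" if "3 \<le> c" "c \<le> c'" "c' < n" for c c'
    using that(2,3)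
  proof (induction c' rule: dec_induct)
    case (step b)
    then have "set_encode (f (Suc b)) \<le> set_encode (f b)" using that(1) by (intro fd) auto
    moreover have "lex_value n (u e) = set_encode (f e)" if "e \<in> {b, Suc b}" for e
      using that step f[of e] \<open>3 \<le> c\<close> unfolding u_def by (intro lex_value_reflect) auto
    ultimately show ?case using step by simp
  qed simp
  ultimately show ?thesis using that by blast
qed

text \<open>At the first difference \<open>v\<close> has a digit of weight 2^(n - a), while
  \<open>u\<close> has only later digits left, which together weigh less.\<close>

lemma slex_greater_lex_value:
  assumes "slex_greater v u" "Poly_Mapping.keys u \<subseteq> {1..n}" "Poly_Mapping.keys v \<subseteq> {1..n}"
  shows "lex_value n (Poly_Mapping.keys u) < lex_value n (Poly_Mapping.keys v)"
proof -
  define xs ys where "xs = sorted_list_of_set (Poly_Mapping.keys v)" "ys = sorted_list_of_set (Poly_Mapping.keys u)"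
  obtain s where s: "s < length xs" "s < length ys" "take s xs = take s ys" "xs ! s < ys ! s"
    using assms(1) unfolding slex_greater_def Let_def xs_ys_def by blast
  have set: "set xs = Poly_Mapping.keys v" "set ys = Poly_Mapping.keys u"
    and xs: "distinct xs" and ys: "sorted ys" by (simp_all add: xs_ys_def)
  \<comment> \<open>\<open>P\<close> is the common prefix of the two index lists, and
    \<open>a\<close> the first index of \<open>v\<close> that \<open>u\<close> lacks.\<close>
  define P a where "P = set (take s xs)" "a = xs ! s"
  have aP: "a \<notin> P" "finite P" using xs s(1) by (auto simp: P_a_def in_set_conv_nth nth_eq_iff_index_eq)
  have an: "a \<le> n" using nth_mem[OF s(1)] set assms(3) by (auto simp: P_a_def)
  have "Poly_Mapping.keys u \<subseteq> P \<union> {a<..n}"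
  proof
    fix x assume x: "x \<in> Poly_Mapping.keys u"
    then obtain i where i: "i < length ys" "x = ys ! i" using set(2) by (metis in_set_conv_nth)
    show "x \<in> P \<union> {a<..n}"
    proof (cases "i < s")
      case True
      then have "x \<in> set (take s ys)" using i by (auto simp: in_set_conv_nth)
      then show ?thesis by (simp add: P_a_def s(3))
    next
      case False
      then have "a < x" using s(4) sorted_nth_mono[OF ys, of s i] i by (simp add: P_a_def)
      then show ?thesis using x assms(2) by auto
    qed
  qed
  then have "lex_value n (Poly_Mapping.keys u) \<le> lex_value n (P \<union> {a<..n})"
    using aP by (intro lex_value_mono) auto
  also have "\<dots> \<le> lex_value n P + lex_value n {a<..n}"
    unfolding lex_value_def using aP by (subst sum.union_inter[symmetric]) auto
  also have "lex_value n {a<..n} < 2 ^ (n - a)"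
  proof -
    have "(\<lambda>i. n - i) ` {..<n - a} = {a<..n}"
    proof (intro equalityI subsetI)
      fix x assume "x \<in> {a<..n}"
      then show "x \<in> (\<lambda>i. n - i) ` {..<n - a}" by (intro image_eqI[of _ _ "n - x"]) auto
    qed (use an in auto)
    then have "lex_value n {a<..n} = set_encode {..<n - a}"
      using lex_value_reflect[of "{..<n - a}" n] by auto
    then show ?thesis using set_encode_less_power[of "{..<n - a}"] by simp
  qed
  also have "lex_value n P + 2 ^ (n - a) = lex_value n (insert a P)"
    using aP by (simp add: lex_value_def)
  also have "\<dots> \<le> lex_value n (Poly_Mapping.keys v)"
    using s(1) set(1) set_take_subset[of s xs] nth_mem[OF s(1)] by (intro lex_value_mono) (auto simp: P_a_def)
  finally show ?thesis by simp
qed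

section \<open>Squarefree monomials and membership in support ideals\<close>

lemma squarefree_monomial_eq_set_monom:
  assumes "m \<in> squarefree_monomials n"
  shows "m = set_monom (Poly_Mapping.keys m)"
proof (rule poly_mapping_eqI)
  fix i
  have "Poly_Mapping.lookup m i \<le> 1" using assms by (simp add: squarefree_monomials_def)
  then show "Poly_Mapping.lookup m i = Poly_Mapping.lookup (set_monom (Poly_Mapping.keys m)) i"
    by (auto simp: lookup_set_monom in_keys_iff)
qed

lemma mdeg_squarefree: "m \<in> squarefree_monomials n \<Longrightarrow> mdeg m = card (Poly_Mapping.keys m)"
  using mdeg_set_monom[of "Poly_Mapping.keys m"] squarefree_monomial_eq_set_monom[of m n] by simp

lemma card_keys_le_mdeg: "card (Poly_Mapping.keys m) \<le> mdeg m"
proof -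
  have "(\<Sum>i\<in>Poly_Mapping.keys m. 1) \<le> mdeg m"
    unfolding mdeg_def by (intro sum_mono) (auto simp: in_keys_iff)
  then show ?thesis by simp
qed

lemma monom_poly_in_support_ideal:
  "(monom_poly m :: 'k::field mpoly) \<in> support_ideal n Q \<longleftrightarrow> Poly_Mapping.keys m \<subseteq> {1..n} \<and> Q (Poly_Mapping.keys m)"
  by (simp add: support_ideal_def monom_poly_def)

text \<open>All squarefree monomials of the ideal serve as generators: a support satisfying
  \<open>Q\<close> is that of its own squarefree monomial.\<close>

lemma squarefree_monomial_ideal_support_ideal:
  assumes Q: "\<And>A B. Q A \<Longrightarrow> A \<subseteq> B \<Longrightarrow> B \<subseteq> {1..n} \<Longrightarrow> Q B"
  shows "squarefree_monomial_ideal n (support_ideal n Q :: 'k::field mpoly set)"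
proof -
  define G where "G = {m \<in> squarefree_monomials n. Q (Poly_Mapping.keys m)}"
  have "Q A \<longleftrightarrow> (\<exists>g\<in>G. Poly_Mapping.keys g \<subseteq> A)" if A: "A \<subseteq> {1..n}" for A
  proof
    assume "Q A"
    have "finite A" using A finite_subset by blast
    then have "set_monom A \<in> G"
      using \<open>Q A\<close> A by (simp add: G_def squarefree_monomials_def monomials_def keys_set_monom lookup_set_monom)
    then show "\<exists>g\<in>G. Poly_Mapping.keys g \<subseteq> A" using \<open>finite A\<close>
      by (intro bexI[of _ "set_monom A"]) (simp_all add: keys_set_monom)
  qed (use Q A in \<open>auto simp: G_def\<close>)
  then have "support_ideal n Q = (support_ideal n (\<lambda>A. \<exists>g\<in>G. Poly_Mapping.keys g \<subseteq> A) :: 'k mpoly set)"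
    unfolding support_ideal_def by blast
  moreover have "G \<subseteq> squarefree_monomials n" by (auto simp: G_def)
  ultimately show ?thesis
    unfolding squarefree_monomial_ideal_def
    by (intro exI[of _ G] conjI) (simp_all only: genideal_eq_support_ideal)
qed

lemma graded_betti_squarefree_eq_0:
  assumes I: "squarefree_monomial_ideal n (I :: 'k::field mpoly set)" and "0 < i" "n < d"
  shows "graded_betti n I i d = 0"
proof -
  obtain G where G: "G \<subseteq> squarefree_monomials n" "I = Idl\<^bsub>poly_ring n\<^esub> (monom_poly ` G)"
    using I unfolding squarefree_monomial_ideal_def by blast
  obtain j where "i = Suc j" using \<open>0 < i\<close> by (cases i) auto
  then show ?thesis
    unfolding G(2) genideal_eq_support_ideal[OF G(1)] using \<open>n < d\<close> by (auto intro!: graded_betti_eq_0)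
qed

section \<open>A squarefree lexsegment ideal with corners \<open>(n - c, c)\<close>\<close>

text \<open>Both closure properties are built into \<open>Q\<close>: cardinality and
  \<open>lex_value\<close> grow with the support, and an slex greater monomial of the same degree
  has a larger value. The condition \<open>c \<le> card A\<close> leaves nothing in degrees below
  \<open>l1\<close>, as a support has at most as many elements as the degree.\<close>

lemma squarefree_lexsegment_ideal_corners:
  assumes l1: "3 \<le> l1" "l1 < n"
  obtains I :: "'k::field mpoly set" where "squarefree_lexsegment_ideal n I" "has_initial_degree I l1"
    "\<And>c. l1 \<le> c \<Longrightarrow> c < n \<Longrightarrow> is_corner n I (n - c) c"
proof -
  obtain u where u: "\<And>c. c \<in> {3..<n} \<Longrightarrow> u c \<subseteq> {1..n} \<and> n \<in> u c \<and> card (u c) = c"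
    and ud: "\<And>c c'. 3 \<le> c \<Longrightarrow> c \<le> c' \<Longrightarrow> c' < n \<Longrightarrow> lex_value n (u c') \<le> lex_value n (u c)"
    by (rule decreasing_lex_values) blast
  define Q where "Q A \<longleftrightarrow> (\<exists>c\<in>{l1..<n}. c \<le> card A \<and> lex_value n (u c) \<le> lex_value n A)" for A
  have Q: "Q B" if "Q A" "A \<subseteq> B" "B \<subseteq> {1..n}" for A B
  proof -
    have "finite B" using that(3) finite_subset by blast
    then show ?thesis
      using that(1) card_mono[OF _ that(2)] lex_value_mono[OF that(2), of n] unfolding Q_def
      by (meson order_trans)
  qed
  define I where "I = (support_ideal n Q :: 'k mpoly set)"
  have sf: "squarefree_monomial_ideal n I"
    unfolding I_def by (rule squarefree_monomial_ideal_support_ideal[OF Q])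
  have "squarefree_lexsegment_ideal n I"
    unfolding squarefree_lexsegment_ideal_def
  proof (intro conjI sf ballI impI)
    fix a b assume a: "a \<in> squarefree_monomials n" and b: "b \<in> squarefree_monomials n"
      and h: "(monom_poly a :: 'k mpoly) \<in> I \<and> mdeg b = mdeg a \<and> slex_greater b a"
    have keys: "Poly_Mapping.keys a \<subseteq> {1..n}" "Poly_Mapping.keys b \<subseteq> {1..n}"
      using a b by (auto simp: squarefree_monomials_def monomials_def)
    have "lex_value n (Poly_Mapping.keys a) < lex_value n (Poly_Mapping.keys b)"
      using h keys by (intro slex_greater_lex_value) simp_all
    moreover have "card (Poly_Mapping.keys b) = card (Poly_Mapping.keys a)"
      using h a b by (simp add: mdeg_squarefree)
    ultimately show "(monom_poly b :: 'k mpoly) \<in> I"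
      using h keys by (fastforce simp: I_def monom_poly_in_support_ideal Q_def)
  qed
  moreover have "has_initial_degree I l1"
    unfolding has_initial_degree_def
  proof (intro conjI allI impI notI)
    have fin: "finite (u l1)" and ul: "u l1 \<subseteq> {1..n}" "card (u l1) = l1"
      using u[of l1] l1 by (auto dest: finite_subset)
    have "(monom_poly (set_monom (u l1)) :: 'k mpoly) \<in> I"
      using fin ul l1 by (auto simp: I_def monom_poly_in_support_ideal keys_set_monom Q_def)
    moreover have "monom_poly m \<noteq> (0 :: 'k mpoly)" for m
      unfolding monom_poly_def by (metis lookup_single_eq lookup_zero one_neq_zero)
    moreover have "homogeneous l1 (monom_poly (set_monom (u l1)) :: 'k mpoly)"
      using fin ul by (simp add: homogeneous_def monom_poly_def mdeg_set_monom)
    ultimately show "\<exists>p\<in>I. p \<noteq> 0 \<and> homogeneous l1 p" by blast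
  next
    fix j assume "j < l1" and "\<exists>p\<in>I. p \<noteq> 0 \<and> homogeneous j p"
    then obtain p where p: "p \<in> I" "p \<noteq> 0" "homogeneous j p" by blast
    then obtain m where m: "m \<in> Poly_Mapping.keys p" by fastforce
    then have "Q (Poly_Mapping.keys m)" "mdeg m = j"
      using p by (auto simp: I_def support_ideal_def homogeneous_def)
    then show False using \<open>j < l1\<close> card_keys_le_mdeg[of m] by (auto simp: Q_def)
  qed
  moreover have "is_corner n I (n - c) c" if c: "l1 \<le> c" "c < n" for c
    unfolding is_corner_def
  proof (intro conjI allI impI)
    have uc: "u c \<subseteq> {1..n}" "n \<in> u c" "card (u c) = c" "finite (u c)"
      using u[of c] c l1 by (auto dest: finite_subset)
    have "graded_betti n I (n - card (u c)) n \<noteq> 0"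
      unfolding I_def
    proof (rule graded_betti_top_nonzero)
      show "u c \<subseteq> {1..n}" "n \<in> u c" "card (u c) < n" using uc c by auto
      fix t
      show "Q (insert t (u c - {n}))" if t: "t \<in> {1..n}" "t \<notin> u c - {n}"
      proof -
        \<comment> \<open>The variable x_n has weight 1, the least possible, so exchanging it for
          \<open>t\<close> keeps the degree \<open>c\<close> and does not lower the value.\<close>
        have "lex_value n (u c) = 1 + lex_value n (u c - {n})"
          unfolding lex_value_def using uc by (subst sum.remove[of _ n]) auto
        also have "\<dots> \<le> lex_value n (insert t (u c - {n}))"
          using uc t by (auto simp: lex_value_def)
        finally show ?thesis
          using uc t c card_Suc_Diff1[OF uc(4,2)] by (auto simp: Q_def intro!: bexI[of _ c])
      qed
      show "\<not> Q (u c - {t})" if t: "t \<in> u c"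
      proof
        assume "Q (u c - {t})"
        then obtain c' where c': "l1 \<le> c'" "c' \<le> card (u c - {t})"
            "lex_value n (u c') \<le> lex_value n (u c - {t})"
          by (auto simp: Q_def)
        \<comment> \<open>Deleting \<open>t\<close> brings the value strictly below that of
          \<open>u c\<close>, while \<open>c' \<le> c\<close> keeps the value of \<open>u c'\<close>
          at or above it.\<close>
        have "lex_value n (u c) = 2 ^ (n - t) + lex_value n (u c - {t})"
          unfolding lex_value_def using uc t by (intro sum.remove)
        moreover have "c' \<le> c" using c'(2) uc t by (simp add: card_Diff_singleton)
        then have "lex_value n (u c) \<le> lex_value n (u c')" using c'(1) l1 c by (intro ud) auto
        moreover have "0 < (2::nat) ^ (n - t)" by simp
        ultimately show False using c'(3) by linarith
      qed
    qed (rule Q)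
    then show "graded_betti n I (n - c) (n - c + c) \<noteq> 0" using uc c by simp
  next
    \<comment> \<open>As \<open>n - c + c = n\<close>, every other pair in this quadrant has
      \<open>i + j > n\<close>.\<close>
    fix i j assume h: "n - c \<le> i \<and> c \<le> j \<and> (i, j) \<noteq> (n - c, c)"
    then show "graded_betti n I i (i + j) = 0"
      using c by (intro graded_betti_squarefree_eq_0[OF sf]) auto
  qed
  ultimately show ?thesis using that by blast
qed

section \<open>Gap estimates for the two sequences, and the equivalence\<close>

lemma strict_mono_on_nat_ge:
  fixes f :: "nat \<Rightarrow> nat"
  assumes f: "strict_mono_on {1..m} f" and i: "i \<in> {1..m}"
  shows "f 1 + i \<le> f i + 1"
proof -
  have "1 \<le> i" "i \<le> m" using i by auto
  then show ?thesis
  proof (induction i rule: dec_induct)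
    case (step j)
    then have "f j < f (Suc j)" by (intro strict_mono_onD[OF f]) auto
    then show ?case using step by simp
  qed simp
qed

lemma strict_antimono_on_nat_ge:
  fixes f :: "nat \<Rightarrow> nat"
  assumes f: "strict_antimono_on {1..m} f" and i: "i \<in> {1..m}"
  shows "f m + (m - i) \<le> f i"
proof -
  have "i \<le> m" "1 \<le> i" using i by auto
  then show ?thesis
  proof (induction i rule: inc_induct)
    case (step j)
    then have "f (Suc j) < f j" by (intro monotone_onD[OF f]) auto
    then show ?case using step by simp
  qed simp
qed

theorem theorem3p13:
  fixes n :: nat and k l :: "nat \<Rightarrow> nat"
  assumes "n \<ge> 5" and "3 \<le> l 1" and "l 1 < n"
    and "1 \<le> k (n - l 1)" and "strict_antimono_on {1..n - l 1} k" and "k 1 \<le> n - 3"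
    and "strict_mono_on {1..n - l 1} l" and "l (n - l 1) \<le> n - 1"
  shows "(\<exists>I :: 'k::field mpoly set.
            squarefree_lexsegment_ideal n I \<and> has_initial_degree I (l 1) \<and>
            (\<forall>i\<in>{1..n - l 1}. is_corner n I (k i) (l i)))
         \<longleftrightarrow> (\<forall>i\<in>{1..n - l 1}. k i + l i = n)"
proof
  assume "\<exists>I :: 'k mpoly set. squarefree_lexsegment_ideal n I \<and> has_initial_degree I (l 1) \<and>
            (\<forall>i\<in>{1..n - l 1}. is_corner n I (k i) (l i))"
  then obtain I :: "'k mpoly set" where sf: "squarefree_monomial_ideal n I"
    and corner: "\<And>i. i \<in> {1..n - l 1} \<Longrightarrow> is_corner n I (k i) (l i)"
    unfolding squarefree_lexsegment_ideal_def by blast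
  show "\<forall>i\<in>{1..n - l 1}. k i + l i = n"
  proof
    fix i assume i: "i \<in> {1..n - l 1}"
    \<comment> \<open>Since the last \<open>k\<close> is at least 1, the lower bounds are
      \<open>1 + (n - l 1 - i)\<close> for \<open>k i\<close> and \<open>l 1 + i - 1\<close> for
      \<open>l i\<close>. They add up to exactly \<open>n\<close>.\<close>
    have k: "k (n - l 1) + (n - l 1 - i) \<le> k i" by (rule strict_antimono_on_nat_ge[OF assms(5) i])
    moreover have l: "l 1 + i \<le> l i + 1" by (rule strict_mono_on_nat_ge[OF assms(7) i])
    ultimately have "n \<le> k i + l i" using assms(3,4) i by auto
    moreover have "k i + l i \<le> n"
    proof (rule ccontr)
      assume "\<not> k i + l i \<le> n"
      then have "graded_betti n I (k i) (k i + l i) = 0"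
        using k assms(4) by (intro graded_betti_squarefree_eq_0[OF sf]) auto
      then show False using corner[OF i] by (simp add: is_corner_def)
    qed
    ultimately show "k i + l i = n" by simp
  qed
next
  assume sum: "\<forall>i\<in>{1..n - l 1}. k i + l i = n"
  obtain I :: "'k mpoly set" where I: "squarefree_lexsegment_ideal n I" "has_initial_degree I (l 1)"
    "\<And>c. l 1 \<le> c \<Longrightarrow> c < n \<Longrightarrow> is_corner n I (n - c) c"
    using squarefree_lexsegment_ideal_corners[OF assms(2,3)] by blast
  have "is_corner n I (k i) (l i)" if i: "i \<in> {1..n - l 1}" for i
  proof -
    have "l 1 \<le> l i" using strict_mono_on_nat_ge[OF assms(7) i] i by simp
    moreover have "k (n - l 1) + (n - l 1 - i) \<le> k i" by (rule strict_antimono_on_nat_ge[OF assms(5) i])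
    \<comment> \<open>Every \<open>k i\<close> is at least 1, so \<open>k i + l i = n\<close> keeps
      \<open>l i\<close> in the range of degrees where the ideal has corners.\<close>
    then have "l i < n" using sum i assms(4) by fastforce
    moreover have "k i = n - l i" using sum i by fastforce
    ultimately show ?thesis using I(3) by simp
  qed
  then show "\<exists>I :: 'k mpoly set. squarefree_lexsegment_ideal n I \<and> has_initial_degree I (l 1) \<and>
            (\<forall>i\<in>{1..n - l 1}. is_corner n I (k i) (l i))"
    using I(1,2) by blast
qed

end
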